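(* Let $X$ be a Banach space, let $\mathcal T$, $P$ and $WW_{X^*}(\mathbb R,X^{**})_a$ be as described in the context, and let $f\in WW_{X^*}(\mathbb R,X^{**})_a$. Assume that the $\sigma(X^{**},X^* )$-closure of $f(\mathbb R)$ is norm separable in $X^{**}$, and that for some $s\in\mathbb R$ the map $F:(B_{X^*},\sigma(X^*,X))\times(\mathcal T,w^* )\to\mathbb C$, $F(x^*,U)=\langle x^*,(Uf)(s)\rangle$, is (jointly) continuous. Then $f\in AP(\mathbb R,X^{**})$.
   Context: $W(\mathbb R)$ is the set of bounded continuous $g:\mathbb R\to\mathbb C$ whose translates $\{g(\cdot+t):t\in\mathbb R\}$ are relatively weakly compact in $C_b(\mathbb R)$. $WW_{X^*}(\mathbb R,X^{**}):=\{f\in BUC(\mathbb R,X^{**}): t\mapsto\langle x^*,f(t)\rangle\in W(\mathbb R)\ \forall x^*\in X^*\}$, viewed inside $L^1(\mathbb R,X^* )^*$ via $\langle g,f\rangle=\int_{\mathbb R}\langle g(r),f(r)\rangle\,dr$; its $w^*$-topology is $\sigma(\cdot,L^1(\mathbb R,X^* ))$. $\{T(t)\}_{t\in\mathbb R}$ is the translation group $(T(t)f)(r)=f(r+t)$ on this space, and $\mathcal T$ is the closure of $\{T(t)\}$ in the topology of pointwise $w^*$-convergence ($U_\alpha\to U$ iff $\langle g,U_\alpha f\rangle\to\langle g,Uf\rangle$ for all $g\in L^1(\mathbb R,X^* )$, $f\in WW_{X^*}(\mathbb R,X^{**})$); it consists of operators on $WW_{X^*}(\mathbb R,X^{**})$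 and is a compact semigroup under composition. $P$ is a minimal idempotent of $\mathcal T$ (an idempotent such that every idempotent $Q\in\mathcal T$ with $PQ=Q$ satisfies $QP=P$), and $WW_{X^*}(\mathbb R,X^{**})_a:=P\,WW_{X^*}(\mathbb R,X^{**})$. $AP(\mathbb R,Z)$ denotes the continuous functions $\mathbb R\to Z$ whose set of translates is relatively compact in the sup norm (Bohr almost periodic functions). *)

theory Defs
  imports "HOL-Analysis.Analysis" "HOL-Library.FuncSet"
begin

text \<open>X is a complex Banach space, modelled by a real Banach space type 'a together with a
 complex structure J (multiplication by the imaginary unit): c x = Re c x + Im c J x.
 Dual X^* : complex-linear bounded functionals 'a => complex (a carrier set).
 Bidual X^** : complex-linear bounded functionals on X^*, represented extensionally
 (value 0 outside X^*).\<close>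

type_synonym 'a dualv = "'a \<Rightarrow> complex"
type_synonym 'a bidualv = "('a \<Rightarrow> complex) \<Rightarrow> complex"

definition cscale :: "('a::banach \<Rightarrow> 'a) \<Rightarrow> complex \<Rightarrow> 'a \<Rightarrow> 'a" where
  "cscale J c x = Re c *\<^sub>R x + Im c *\<^sub>R J x"

definition complex_structure :: "('a::banach \<Rightarrow> 'a) \<Rightarrow> bool" where
  "complex_structure J \<longleftrightarrow> bounded_linear J \<and> (\<forall>x. J (J x) = - x) \<and>
     (\<forall>c x. norm (cscale J c x) = cmod c * norm x)"

definition cdual :: "('a::banach \<Rightarrow> 'a) \<Rightarrow> 'a dualv set" where
  "cdual J = {\<phi>. bounded_linear \<phi> \<and> (\<forall>c x. \<phi> (cscale J c x) = c * \<phi> x)}"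

definition dnorm :: "('a::banach) dualv \<Rightarrow> real" where
  "dnorm \<phi> = onorm \<phi>"

definition dual_ball :: "('a::banach \<Rightarrow> 'a) \<Rightarrow> 'a dualv set" where
  "dual_ball J = {\<phi> \<in> cdual J. dnorm \<phi> \<le> 1}"

definition bidual :: "('a::banach \<Rightarrow> 'a) \<Rightarrow> 'a bidualv set" where
  "bidual J = {\<xi>. (\<forall>\<phi>\<in>cdual J. \<forall>\<psi>\<in>cdual J. \<xi> (\<lambda>x. \<phi> x + \<psi> x) = \<xi> \<phi> + \<xi> \<psi>)
              \<and> (\<forall>c. \<forall>\<phi>\<in>cdual J. \<xi> (\<lambda>x. c * \<phi> x) = c * \<xi> \<phi>)
              \<and> (\<exists>K. \<forall>\<phi>\<in>cdual J. cmod (\<xi> \<phi>) \<le> K * dnorm \<phi>)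
              \<and> (\<forall>\<phi>. \<phi> \<notin> cdual J \<longrightarrow> \<xi> \<phi> = 0)}"

definition bnorm :: "('a::banach \<Rightarrow> 'a) \<Rightarrow> 'a bidualv \<Rightarrow> real" where
  "bnorm J \<xi> = (SUP \<phi>\<in>dual_ball J. cmod (\<xi> \<phi>))"

definition bdist :: "('a::banach \<Rightarrow> 'a) \<Rightarrow> 'a bidualv \<Rightarrow> 'a bidualv \<Rightarrow> real" where
  "bdist J \<xi> \<eta> = bnorm J (\<lambda>\<phi>. \<xi> \<phi> - \<eta> \<phi>)"

definition weakstar_dual :: "('a::banach \<Rightarrow> 'a) \<Rightarrow> 'a dualv topology" where
  "weakstar_dual J = topology_generated_by {{\<phi>\<in>cdual J. \<phi> x \<in> U} | x U. open U}"

definition weakstar_bidual :: "('a::banach \<Rightarrow> 'a) \<Rightarrow> 'a bidualv topology" where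
  "weakstar_bidual J = topology_generated_by {{\<xi>\<in>bidual J. \<xi> \<phi> \<in> U} | \<phi> U. \<phi> \<in> cdual J \<and> open U}"

definition norm_separable :: "('a::banach \<Rightarrow> 'a) \<Rightarrow> 'a bidualv set \<Rightarrow> bool" where
  "norm_separable J S \<longleftrightarrow> (\<exists>D. countable D \<and> D \<subseteq> S \<and>
      (\<forall>\<xi>\<in>S. \<forall>e>0. \<exists>\<eta>\<in>D. bdist J \<xi> \<eta> < e))"

definition BUC :: "('a::banach \<Rightarrow> 'a) \<Rightarrow> (real \<Rightarrow> 'a bidualv) set" where
  "BUC J = {f. (\<forall>r. f r \<in> bidual J) \<and> (\<exists>B. \<forall>r. bnorm J (f r) \<le> B) \<and>
            (\<forall>e>0. \<exists>d>0. \<forall>r s. \<bar>r - s\<bar> < d \<longrightarrow> bdist J (f r) (f s) < e)}"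

text \<open>Weak topology of C_b(R) (generated by all bounded linear functionals; real-linear
  complex-valued functionals generate the same topology as the complex-linear ones).\<close>
definition weak_Cb :: "(real \<Rightarrow>\<^sub>C complex) topology" where
  "weak_Cb = topology_generated_by {L -` U | L U. bounded_linear L \<and> open (U::complex set)}"

definition Wfun :: "(real \<Rightarrow> complex) set" where
  "Wfun = {g. continuous_on UNIV g \<and> bounded (range g) \<and>
     compactin weak_Cb (weak_Cb closure_of {Bcontfun (\<lambda>r. g (r + t)) | t. True})}"

definition WW :: "('a::banach \<Rightarrow> 'a) \<Rightarrow> (real \<Rightarrow> 'a bidualv) set" where
  "WW J = {f \<in> BUC J. \<forall>\<phi>\<in>cdual J. (\<lambda>t. f t \<phi>) \<in> Wfun}"

definition strongly_measurable :: "('a::banach \<Rightarrow> 'a) \<Rightarrow> (real \<Rightarrow> 'a dualv) \<Rightarrow> bool" where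
  "strongly_measurable J g \<longleftrightarrow> (\<exists>s :: nat \<Rightarrow> real \<Rightarrow> 'a dualv.
      (\<forall>n. finite (range (s n)) \<and> range (s n) \<subseteq> cdual J \<and>
           (\<forall>y. s n -` {y} \<in> sets lebesgue)) \<and>
      (AE r in lebesgue. (\<lambda>n. dnorm (\<lambda>x. s n r x - g r x)) \<longlonglongrightarrow> 0))"

definition L1 :: "('a::banach \<Rightarrow> 'a) \<Rightarrow> (real \<Rightarrow> 'a dualv) set" where
  "L1 J = {g. (\<forall>r. g r \<in> cdual J) \<and> strongly_measurable J g \<and>
            (\<integral>\<^sup>+ r. ennreal (dnorm (g r)) \<partial>lebesgue) < \<infinity>}"

definition pairing :: "(real \<Rightarrow> ('a::banach) dualv) \<Rightarrow> (real \<Rightarrow> 'a bidualv) \<Rightarrow> complex" where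
  "pairing g f = (\<integral> r. f r (g r) \<partial>lebesgue)"

definition wstar_WW :: "('a::banach \<Rightarrow> 'a) \<Rightarrow> (real \<Rightarrow> 'a bidualv) topology" where
  "wstar_WW J = topology_generated_by {{f\<in>WW J. pairing g f \<in> U} | g U. g \<in> L1 J \<and> open U}"

definition transl :: "real \<Rightarrow> (real \<Rightarrow> ('a::banach) bidualv) \<Rightarrow> (real \<Rightarrow> 'a bidualv)" where
  "transl t f = (\<lambda>r. f (r + t))"

text \<open>Topology of pointwise w^*-convergence on operators WW -> WW
  (operators represented as extensional functions on WW).\<close>
definition op_top :: "('a::banach \<Rightarrow> 'a) \<Rightarrow> ((real \<Rightarrow> 'a bidualv) \<Rightarrow> (real \<Rightarrow> 'a bidualv)) topology" where
  "op_top J = product_topology (\<lambda>_. wstar_WW J) (WW J)"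

definition Tcal :: "('a::banach \<Rightarrow> 'a) \<Rightarrow> ((real \<Rightarrow> 'a bidualv) \<Rightarrow> (real \<Rightarrow> 'a bidualv)) set" where
  "Tcal J = op_top J closure_of {restrict (transl t) (WW J) | t. True}"

definition Tcal_top :: "('a::banach \<Rightarrow> 'a) \<Rightarrow> ((real \<Rightarrow> 'a bidualv) \<Rightarrow> (real \<Rightarrow> 'a bidualv)) topology" where
  "Tcal_top J = subtopology (op_top J) (Tcal J)"

definition minimal_idempotent :: "('a::banach \<Rightarrow> 'a) \<Rightarrow> ((real \<Rightarrow> 'a bidualv) \<Rightarrow> (real \<Rightarrow> 'a bidualv)) \<Rightarrow> bool" where
  "minimal_idempotent J P \<longleftrightarrow> P \<in> Tcal J \<and> compose (WW J) P P = P \<and>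
     (\<forall>Q\<in>Tcal J. compose (WW J) Q Q = Q \<and> compose (WW J) P Q = Q \<longrightarrow> compose (WW J) Q P = P)"

text \<open>AP(R, X^**): norm-continuous with relatively compact (sup norm) set of translates;
  relative compactness in the metric space of bounded functions is expressed sequentially.\<close>
definition AP_bidual :: "('a::banach \<Rightarrow> 'a) \<Rightarrow> (real \<Rightarrow> 'a bidualv) set" where
  "AP_bidual J = {f. (\<forall>r. f r \<in> bidual J) \<and>
     (\<forall>r. \<forall>e>0. \<exists>d>0. \<forall>s. \<bar>s - r\<bar> < d \<longrightarrow> bdist J (f s) (f r) < e) \<and>
     (\<forall>t :: nat \<Rightarrow> real. \<exists>(\<sigma>::nat \<Rightarrow> nat) h. strict_mono \<sigma> \<and> (\<forall>r. h r \<in> bidual J) \<and>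
        (\<forall>e>0. \<exists>N. \<forall>n\<ge>N. \<forall>r. bdist J (f (r + t (\<sigma> n))) (h r) < e))}"

end

theory Submission
  imports Defs "HOL-Library.Diagonal_Subsequence"
begin

text \<open>
  Orbits of translations are relatively compact for pointwise evaluation, and on an orbit closure this
  topology agrees with the w*-topology; hence the closure \<open>\<T>\<close> of the translations is a compact right
  topological semigroup. By the Ellis--Numakura lemma a minimal idempotent \<open>P\<close> is reachable from every
  element \<open>U P\<close>. For a functional \<open>\<phi>\<close>, weak compactness and Hahn--Banach make the orbit closure of
  \<open>f(\<cdot>) \<phi>\<close> norm separable, so Baire category yields a nonempty open subset of small sup-norm diameter in
  the minimal left ideal \<open>\<T> P\<close>; minimality spreads it over the ideal, and compactness makes \<open>f(\<cdot>) \<phi>\<close>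
  almost periodic. Joint continuity, with the dual ball and \<open>\<T>\<close> compact, makes \<open>f(\<real>)\<close> totally bounded
  in norm, so finitely many functionals control the whole dual ball up to a small error, and the scalar
  statements combine to almost periodicity of \<open>f\<close>.
\<close>

section \<open>Hahn--Banach and separable subspaces\<close>

text \<open>Composition of operators is shown continuous in its left factor only, except that a
  translation may stand in front of a varying operator. This shapes the argument: a small open set
  can be moved around the ideal by translations alone. Reachability supplies some \<open>W'\<close>
  in \<open>Tcal\<close> with \<open>W' U\<close> in the open set, and one-sided continuity replaces
  \<open>W'\<close> by a translation, which preserves sup distances. Baire category needs countably
  many closed pieces, hence separability of an orbit; this is available for one functional at a
  time, and joint continuity is what makes finitely many functionals sufficient. Hahn-Banach enters
  because the weak closure of the translates inherits norm separability once norm-closed subspaces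
  are known to be weakly closed. Total boundedness is phrased by colourings because the same set of
  times is compared through many pseudometrics, one per functional, and colourings combine by
  pairing colours.\<close>

definition sublinear :: "('a::real_vector \<Rightarrow> real) \<Rightarrow> bool" where
  "sublinear p \<longleftrightarrow> (\<forall>x y. p (x + y) \<le> p x + p y) \<and> (\<forall>c x. 0 \<le> c \<longrightarrow> p (c *\<^sub>R x) = c * p x)"

text \<open>One inequality for positive scalars is enough: applied to \<open>inverse c\<close> and
  \<open>c *\<^sub>R x\<close> it yields the reverse one.\<close>

lemma sublinearI:
  assumes add: "\<And>x y. p (x + y) \<le> p x + p y" and zero: "p 0 = 0"
    and scale: "\<And>c x. 0 < c \<Longrightarrow> p (c *\<^sub>R x) \<le> c * p x"
  shows "sublinear p"
  unfolding sublinear_def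
proof (intro conjI allI impI)
  fix c :: real and x assume "0 \<le> c"
  show "p (c *\<^sub>R x) = c * p x"
  proof (cases "c = 0")
    case False
    with \<open>0 \<le> c\<close> have c: "0 < c" by simp
    have "p x \<le> inverse c * p (c *\<^sub>R x)"
      using scale[of "inverse c" "c *\<^sub>R x"] c by simp
    then have "c * p x \<le> p (c *\<^sub>R x)"
      using c by (simp add: field_simps)
    with scale[OF c, of x] show ?thesis by simp
  qed (simp add: zero)
qed (rule add)

lemma sublinearD:
  assumes "sublinear p"
  shows "p (x + y) \<le> p x + p y" "0 \<le> c \<Longrightarrow> p (c *\<^sub>R x) = c * p x" "p 0 = 0" "- p (- x) \<le> p x"
proof -
  show add: "p (x + y) \<le> p x + p y" for x y using assms by (simp add: sublinear_def)
  show sc: "0 \<le> c \<Longrightarrow> p (c *\<^sub>R x) = c * p x" for c x using assms by (simp add: sublinear_def)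
  show "p 0 = 0" using sc[of 0 0] by simp
  then show "- p (- x) \<le> p x" using add[of x "-x"] by simp
qed

text \<open>With \<open>t = 0\<close> the bound says \<open>q \<le> p\<close>; with
  \<open>x = - y\<close> and \<open>t = 1\<close> it says \<open>q (- y) \<le> - p y\<close>. So
  every linear functional below \<open>q\<close> takes exactly the value \<open>p y\<close> at
  \<open>y\<close>. This serves both to show that minimal sublinear functionals are additive and to
  keep a functional nonzero at a given vector.\<close>

lemma sublinear_shift:
  assumes p: "sublinear p"
  obtains q where "sublinear q" "\<And>x t. 0 \<le> t \<Longrightarrow> q x \<le> p (x + t *\<^sub>R y) - t * p y"
proof
  define q where "q x = (INF t\<in>{0..}. p (x + t *\<^sub>R y) - t * p y)" for x
  \<comment> \<open>A real infimum is informative only for sets bounded below; this bound does not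
    depend on \<open>t\<close>.\<close>
  have lower: "- p (- x) \<le> p (x + t *\<^sub>R y) - t * p y" if "0 \<le> t" for t x
    using sublinearD(1)[OF p, of "x + t *\<^sub>R y" "- x"] sublinearD(2)[OF p, of t y] that by simp
  then have bdd: "bdd_below ((\<lambda>t. p (x + t *\<^sub>R y) - t * p y) ` {0..})" for x
    by (intro bdd_belowI[of _ "- p (- x)"]) auto
  show le: "q x \<le> p (x + t *\<^sub>R y) - t * p y" if "0 \<le> t" for x t
    unfolding q_def using that by (intro cINF_lower bdd) auto
  show "sublinear q"
  proof (rule sublinearI)
    fix x z
    have "q (x + z) - (p (x + t *\<^sub>R y) - t * p y) \<le> q z" if "0 \<le> t" for t
      unfolding q_def[of z]
    proof (rule cINF_greatest)
      fix u :: real assume "u \<in> {0..}"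
      then have "q (x + z) \<le> p (x + z + (t + u) *\<^sub>R y) - (t + u) * p y"
        using that by (intro le) simp
      also have "p (x + z + (t + u) *\<^sub>R y) \<le> p (x + t *\<^sub>R y) + p (z + u *\<^sub>R y)"
        using sublinearD(1)[OF p, of "x + t *\<^sub>R y" "z + u *\<^sub>R y"] by (simp add: algebra_simps)
      finally show "q (x + z) - (p (x + t *\<^sub>R y) - t * p y) \<le> p (z + u *\<^sub>R y) - u * p y"
        by (simp add: algebra_simps)
    qed auto
    then have "q (x + z) - q z \<le> q x"
      unfolding q_def[of x] by (intro cINF_greatest) (auto simp: algebra_simps)
    then show "q (x + z) \<le> q x + q z" by simp
  next
    have "q 0 \<le> 0" using le[of 0 0] sublinearD(3)[OF p] by simp
    moreover have "0 \<le> q 0"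
      unfolding q_def by (intro cINF_greatest) (auto simp: sublinearD(2)[OF p])
    ultimately show "q 0 = 0" by simp
  next
    fix c :: real and x assume c: "0 < c"
    have "q (c *\<^sub>R x) / c \<le> q x"
      unfolding q_def[of x]
    proof (rule cINF_greatest)
      fix t :: real assume t: "t \<in> {0..}"
      have "q (c *\<^sub>R x) \<le> p (c *\<^sub>R x + (c * t) *\<^sub>R y) - (c * t) * p y"
        using c t by (intro le) simp
      also have "p (c *\<^sub>R x + (c * t) *\<^sub>R y) = c * p (x + t *\<^sub>R y)"
        using sublinearD(2)[OF p, of c "x + t *\<^sub>R y"] c by (simp add: scaleR_add_right)
      finally show "q (c *\<^sub>R x) / c \<le> p (x + t *\<^sub>R y) - t * p y"
        using c by (simp add: field_simps)
    qed auto
    then show "q (c *\<^sub>R x) \<le> c * q x" using c by (simp add: field_simps)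
  qed
qed

text \<open>Subadditivity is where the chain is used: \<open>q\<close> at \<open>x\<close> and
  \<open>r\<close> at \<open>y\<close> are both bounded below by the smaller of the two functionals,
  which is subadditive itself.\<close>

lemma sublinear_INF_chain:
  assumes ne: "C \<noteq> {}" and sub: "\<And>q. q \<in> C \<Longrightarrow> sublinear q \<and> q \<le> p"
    and chain: "\<And>q r. q \<in> C \<Longrightarrow> r \<in> C \<Longrightarrow> q \<le> r \<or> r \<le> q"
  shows "sublinear (\<lambda>x. INF q\<in>C. q x)" "\<And>q x. q \<in> C \<Longrightarrow> (INF q\<in>C. q x) \<le> q x"
proof -
  have bdd: "bdd_below ((\<lambda>q. q x) ` C)" for x
  proof (rule bdd_belowI)
    fix z assume "z \<in> (\<lambda>q. q x) ` C"
    then obtain q where q: "q \<in> C" "z = q x" by auto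
    then show "- p (- x) \<le> z"
      using sublinearD(4)[of q x] sub[OF q(1)] le_funD[of q p "-x"] by force
  qed
  show le: "(INF q\<in>C. q x) \<le> q x" if "q \<in> C" for q x
    using that by (intro cINF_lower bdd)
  show "sublinear (\<lambda>x. INF q\<in>C. q x)"
  proof (rule sublinearI)
    fix x y
    have *: "(INF q\<in>C. q (x + y)) \<le> q x + r y" if qr: "q \<in> C" "r \<in> C" for q r
    proof -
      obtain s where s: "s \<in> C" "s \<le> q" "s \<le> r" using chain[OF qr] qr by auto
      have "(INF q\<in>C. q (x + y)) \<le> s x + s y"
        using le[OF s(1), of "x + y"] sublinearD(1)[of s x y] sub[OF s(1)] by simp
      with le_funD[OF s(2), of x] le_funD[OF s(3), of y] show ?thesis by simp
    qed
    have "(INF q\<in>C. q (x + y)) - q x \<le> (INF q\<in>C. q y)" if "q \<in> C" for q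
      using *[OF that] by (intro cINF_greatest[OF ne]) (simp add: algebra_simps)
    then have "(INF q\<in>C. q (x + y)) - (INF q\<in>C. q y) \<le> (INF q\<in>C. q x)"
      by (intro cINF_greatest[OF ne]) (simp add: algebra_simps)
    then show "(INF q\<in>C. q (x + y)) \<le> (INF q\<in>C. q x) + (INF q\<in>C. q y)" by simp
  next
    have "(INF q\<in>C. q 0) = (INF q\<in>C. 0)"
      using sub sublinearD(3) by (intro INF_cong) auto
    then show "(INF q\<in>C. q 0) = 0" using ne by simp
  next
    fix c :: real and x assume c: "0 < c"
    have "(INF q\<in>C. q (c *\<^sub>R x)) / c \<le> (INF q\<in>C. q x)"
    proof (rule cINF_greatest[OF ne])
      fix q assume q: "q \<in> C"
      then show "(INF q\<in>C. q (c *\<^sub>R x)) / c \<le> q x"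
        using le[OF q, of "c *\<^sub>R x"] sublinearD(2)[of q c x] sub[OF q] c by (simp add: field_simps)
    qed
    then show "(INF q\<in>C. q (c *\<^sub>R x)) \<le> c * (INF q\<in>C. q x)" using c by (simp add: field_simps)
  qed
qed

text \<open>A minimal sublinear functional is linear, since shifting it (\<open>sublinear_shift\<close>)
  cannot make it smaller.\<close>

lemma linear_below_sublinear:
  assumes p: "sublinear (p :: 'a::real_vector \<Rightarrow> real)"
  obtains L where "linear L" "L \<le> p"
proof -
  define A where "A = {q. sublinear q \<and> q \<le> p}"
  have "\<exists>m\<in>A. \<forall>a\<in>A. a \<le> m \<longrightarrow> a = m"
  proof (rule predicate_Zorn)
    show "partial_order_on A (relation_of (\<lambda>a b. b \<le> a) A)"
      by (auto simp: partial_order_on_def preorder_on_def refl_on_def trans_def antisym_def relation_of_def)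
  next
    fix C assume C: "C \<in> Chains (relation_of (\<lambda>a b. b \<le> a) A)"
    show "\<exists>u\<in>A. \<forall>a\<in>C. u \<le> a"
    proof (cases "C = {}")
      case True
      with p show ?thesis by (auto simp: A_def)
    next
      case False
      have sub: "sublinear q \<and> q \<le> p" if "q \<in> C" for q
        using C that by (auto simp: Chains_def relation_of_def A_def)
      have chain: "q \<le> r \<or> r \<le> q" if "q \<in> C" "r \<in> C" for q r
        using C that by (auto simp: Chains_def relation_of_def)
      have u: "sublinear (\<lambda>x. INF q\<in>C. q x)" "(INF q\<in>C. q x) \<le> q x" if "q \<in> C" for q x
        using sublinear_INF_chain[OF False, of p] sub chain that by blast+
      obtain q where q: "q \<in> C" using False by auto
      have "(\<lambda>x. INF q\<in>C. q x) \<le> q" using u(2)[OF q] by (auto intro!: le_funI)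
      then have "(\<lambda>x. INF q\<in>C. q x) \<in> A"
        using u(1)[OF q] sub[OF q] unfolding A_def by fastforce
      then show ?thesis using u(2) by (intro bexI[of _ "\<lambda>x. INF q\<in>C. q x"]) (auto intro!: le_funI)
    qed
  qed
  then obtain q where q: "sublinear q" "q \<le> p"
    and min: "\<And>r. sublinear r \<Longrightarrow> r \<le> q \<Longrightarrow> r = q"
    unfolding A_def by (auto intro: order_trans)
  have add: "q (x + y) = q x + q y" for x y
  proof -
    obtain r where r: "sublinear r" "\<And>x t. 0 \<le> t \<Longrightarrow> r x \<le> q (x + t *\<^sub>R y) - t * q y"
      using sublinear_shift[OF q(1)] by metis
    have "r x \<le> q x" for x using r(2)[of 0 x] by simp
    then have "r = q" by (intro min r le_funI)
    with r(2)[of 1 x] sublinearD(1)[OF q(1), of x y] show ?thesis by simp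
  qed
  have neg: "q (- x) = - q x" for x
    using add[of x "- x"] sublinearD(3)[OF q(1)] by simp
  have "linear q"
  proof (rule linearI)
    fix c :: real and x
    show "q (c *\<^sub>R x) = c *\<^sub>R q x"
      using sublinearD(2)[OF q(1), of c x] sublinearD(2)[OF q(1), of "- c" x] neg[of "c *\<^sub>R x"]
      by (cases "0 \<le> c") auto
  qed (rule add)
  with q(2) show ?thesis using that by blast
qed

lemma sublinear_infdist:
  fixes Y :: "'a::real_normed_vector set"
  assumes "subspace Y"
  shows "sublinear (\<lambda>x. infdist x Y)"
proof (rule sublinearI)
  have ne: "Y \<noteq> {}" and z: "0 \<in> Y" using subspace_0[OF assms] by auto
  show "infdist 0 Y = 0" using z by (rule infdist_zero)
  fix x y :: 'a
  have *: "infdist (x + y) Y \<le> dist x a + dist y b" if "a \<in> Y" "b \<in> Y" for a b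
  proof -
    have "infdist (x + y) Y \<le> dist (x + y) (a + b)"
      using that assms by (intro infdist_le subspace_add)
    also have "\<dots> \<le> dist x a + dist y b" by (rule dist_triangle_add)
    finally show ?thesis .
  qed
  have "infdist (x + y) Y - dist x a \<le> infdist y Y" if "a \<in> Y" for a
    unfolding infdist_notempty[OF ne, of y]
    using *[OF that] by (intro cINF_greatest[OF ne]) (simp add: algebra_simps)
  then have "infdist (x + y) Y - infdist y Y \<le> infdist x Y"
    unfolding infdist_notempty[OF ne, of x]
    by (intro cINF_greatest[OF ne]) (simp add: algebra_simps)
  then show "infdist (x + y) Y \<le> infdist x Y + infdist y Y" by simp
next
  fix c :: real and x :: 'a assume c: "0 < c"
  have ne: "Y \<noteq> {}" using subspace_0[OF assms] by auto
  have "infdist (c *\<^sub>R x) Y / c \<le> infdist x Y"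
    unfolding infdist_notempty[OF ne, of x]
  proof (rule cINF_greatest[OF ne])
    fix a assume "a \<in> Y"
    then have "infdist (c *\<^sub>R x) Y \<le> dist (c *\<^sub>R x) (c *\<^sub>R a)"
      using assms by (intro infdist_le subspace_scale)
    also have "\<dots> = c * dist x a"
      using c by (simp add: dist_norm flip: scaleR_diff_right)
    finally show "infdist (c *\<^sub>R x) Y / c \<le> dist x a" using c by (simp add: field_simps)
  qed
  then show "infdist (c *\<^sub>R x) Y \<le> c * infdist x Y" using c by (simp add: field_simps)
qed

text \<open>A linear functional below the distance to \<open>Y\<close> vanishes on \<open>Y\<close>
  and has norm at most 1. Shifting the distance by \<open>k\<close> before choosing the functional
  forces its value at \<open>k\<close> to be the distance of \<open>k\<close>, which is positive
  because \<open>Y\<close> is closed.\<close>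

lemma Hahn_Banach_closed_subspace:
  fixes Y :: "'a::real_normed_vector set"
  assumes Y: "subspace Y" "closed Y" and k: "k \<notin> Y"
  obtains L :: "'a \<Rightarrow> real" where "bounded_linear L" "\<And>y. y \<in> Y \<Longrightarrow> L y = 0" "L k \<noteq> 0"
proof -
  define p where "p x = infdist x Y" for x
  have p: "sublinear p" using sublinear_infdist[OF Y(1)] by (simp add: p_def[abs_def])
  have z: "0 \<in> Y" using Y(1) by (rule subspace_0)
  obtain q where q: "sublinear q" "\<And>x t. 0 \<le> t \<Longrightarrow> q x \<le> p (x + t *\<^sub>R k) - t * p k"
    using sublinear_shift[OF p] by metis
  obtain L where L: "linear L" "L \<le> q" using linear_below_sublinear[OF q(1)] by blast
  have Lp: "L x \<le> p x" for x
    using le_funD[OF L(2), of x] q(2)[of 0 x] by simp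
  have neg: "L (- x) = - L x" for x using L(1) by (rule linear_neg)
  have "L (- k) \<le> - p k"
    using le_funD[OF L(2), of "- k"] q(2)[of 1 "- k"] sublinearD(3)[OF p] by simp
  moreover have "0 < p k"
    using k Y(2) z infdist_pos_not_in_closed[of Y k] by (auto simp: p_def)
  ultimately have "L k \<noteq> 0" using neg[of k] by simp
  moreover have "L y = 0" if "y \<in> Y" for y
    using Lp[of y] Lp[of "- y"] neg[of y] that subspace_neg[OF Y(1) that] by (simp add: p_def)
  moreover have "bounded_linear L"
  proof (rule linear_conv_bounded_linear[THEN iffD1] | rule bounded_linear_intro[where K = 1])+
    have "p x \<le> norm x" for x using infdist_le[OF z, of x] by (simp add: p_def)
    then show "norm (L x) \<le> norm x * 1" for x
      using Lp[of x] Lp[of "- x"] neg[of x] norm_minus_cancel[of x]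
      by (metis abs_le_iff minus_minus mult.right_neutral order_trans real_norm_def)
  qed (use L(1) in \<open>auto simp: linear_add linear_cmul\<close>)
  ultimately show ?thesis using that by blast
qed

text \<open>\<open>D\<close> consists of the finite rational combinations, indexed by lists:
  countability is that of a list type, and addition is concatenation. Real scalars suffice because
  the separating functional will be real.\<close>

lemma countable_dense_in_closed_subspace:
  fixes s :: "nat \<Rightarrow> 'a::real_normed_vector"
  obtains D where "countable D" "subspace (closure D)" "range s \<subseteq> D"
proof
  define v where "v l = (\<Sum>(c, i)\<leftarrow>l. real_of_rat c *\<^sub>R s i)" for l :: "(rat \<times> nat) list"
  define D where "D = range v"
  show "countable D" unfolding D_def by (rule countable_image) simp
  have "s i = v [(1, i)]" for i by (simp add: v_def)
  then show "range s \<subseteq> D" by (auto simp: D_def)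
  have v_add: "v (l @ l') = v l + v l'" for l l' by (simp add: v_def)
  have v_scale: "v (map (\<lambda>(c, i). (b * c, i)) l) = real_of_rat b *\<^sub>R v l" for b l
    by (induction l) (auto simp: v_def of_rat_mult algebra_simps)
  show "subspace (closure D)"
  proof (rule subspaceI)
    have "v [] \<in> D" by (simp add: D_def)
    then show "0 \<in> closure D" using closure_subset by (fastforce simp: v_def)
  next
    fix x y assume "x \<in> closure D" "y \<in> closure D"
    then obtain a b where "\<And>n. a n \<in> D" "a \<longlonglongrightarrow> x" "\<And>n. b n \<in> D" "b \<longlonglongrightarrow> y"
      by (auto simp: closure_sequential)
    moreover have "z + w \<in> D" if "z \<in> D" "w \<in> D" for z w
      using that by (auto simp: D_def simp flip: v_add)
    ultimately show "x + y \<in> closure D"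
      unfolding closure_sequential
      by (intro exI[of _ "\<lambda>n. a n + b n"]) (auto intro: tendsto_add)
  next
    fix c :: real and x assume "x \<in> closure D"
    then obtain a where a: "\<And>n. a n \<in> D" "a \<longlonglongrightarrow> x"
      by (auto simp: closure_sequential)
    obtain b where b: "\<And>n. b n \<in> \<rat>" "b \<longlonglongrightarrow> c"
      using Rats_closure_real by (metis UNIV_I closure_sequential)
    have "b n *\<^sub>R a n \<in> D" for n
      using a(1)[of n] b(1)[of n] by (auto simp: D_def Rats_def simp flip: v_scale)
    then show "c *\<^sub>R x \<in> closure D"
      unfolding closure_sequential using a b
      by (intro exI[of _ "\<lambda>n. b n *\<^sub>R a n"]) (auto intro: tendsto_scaleR)
  qed
qed

section \<open>Idempotents in compact semigroups, and finite colourings\<close>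

text \<open>In a chain every finite intersection contains a member, and Hausdorffness makes compact
  members closed, so the finite intersection property applies inside one of them.\<close>

lemma compactin_chain_Inter_nonempty:
  assumes X: "Hausdorff_space X" and C: "C \<noteq> {}"
    and A: "\<And>A. A \<in> C \<Longrightarrow> compactin X A \<and> A \<noteq> {}"
    and chain: "\<And>A B. A \<in> C \<Longrightarrow> B \<in> C \<Longrightarrow> A \<subseteq> B \<or> B \<subseteq> A"
  shows "\<Inter>C \<noteq> {}"
proof -
  obtain A0 where A0: "A0 \<in> C" using C by auto
  have min: "\<exists>A\<in>C. A \<subseteq> \<Inter>F" if "finite F" "F \<subseteq> C" for F
    using that
  proof (induction F)
    case empty
    then show ?case using A0 by auto
  next
    case (insert B F)
    then obtain A where "A \<in> C" "A \<subseteq> \<Inter>F" by auto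
    then show ?case using chain[of A B] insert.prems by auto
  qed
  have "A0 \<inter> \<Inter>C \<noteq> {}"
  proof -
    have "A0 \<inter> \<Inter>F \<noteq> {}" if "finite F" "F \<subseteq> C" for F
      using min[of "insert A0 F"] that A0 A by fastforce
    moreover have "\<forall>B\<in>C. closedin X B" using A X compactin_imp_closedin by blast
    ultimately show ?thesis using A[OF A0] unfolding compactin_fip by blast
  qed
  then show ?thesis by auto
qed

text \<open>Take a minimal compact subsemigroup \<open>M\<close> and \<open>e\<close> in it. Then
  \<open>M e\<close> is again a compact subsemigroup, so \<open>M e = M\<close> and some
  \<open>b\<close> satisfies \<open>b e = e\<close>. The solutions \<open>x\<close> of
  \<open>x e = e\<close> therefore form a nonempty compact subsemigroup, which is all of
  \<open>M\<close> and contains \<open>e\<close>. Only the maps \<open>x \<mapsto> x a\<close> have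
  to be continuous.\<close>

lemma Ellis_Numakura:
  assumes X: "Hausdorff_space X" and S: "compactin X S" "S \<noteq> {}"
    and closed: "\<And>x y. x \<in> S \<Longrightarrow> y \<in> S \<Longrightarrow> m x y \<in> S"
    and assoc: "\<And>x y z. x \<in> S \<Longrightarrow> y \<in> S \<Longrightarrow> z \<in> S \<Longrightarrow> m (m x y) z = m x (m y z)"
    and cont: "\<And>a. a \<in> S \<Longrightarrow> continuous_map (subtopology X S) X (\<lambda>x. m x a)"
  obtains e where "e \<in> S" "m e e = e"
proof -
  define \<A> where "\<A> = {A. A \<subseteq> S \<and> A \<noteq> {} \<and> compactin X A \<and> (\<forall>x\<in>A. \<forall>y\<in>A. m x y \<in> A)}"
  have "\<exists>M\<in>\<A>. \<forall>A\<in>\<A>. A \<subseteq> M \<longrightarrow> A = M"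
  proof (rule predicate_Zorn)
    show "partial_order_on \<A> (relation_of (\<lambda>a b. b \<subseteq> a) \<A>)"
      by (auto simp: partial_order_on_def preorder_on_def refl_on_def trans_def antisym_def relation_of_def)
  next
    fix C assume C: "C \<in> Chains (relation_of (\<lambda>a b. b \<subseteq> a) \<A>)"
    show "\<exists>u\<in>\<A>. \<forall>a\<in>C. u \<subseteq> a"
    proof (cases "C = {}")
      case True
      have "S \<in> \<A>" using S closed by (auto simp: \<A>_def)
      with True show ?thesis by auto
    next
      case False
      have chain: "A \<subseteq> B \<or> B \<subseteq> A" if "A \<in> C" "B \<in> C" for A B
        using C that by (auto simp: Chains_def relation_of_def)
      have CA: "C \<subseteq> \<A>" using C by (auto simp: Chains_def relation_of_def)
      have "\<Inter>C \<noteq> {}"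
        using CA chain by (intro compactin_chain_Inter_nonempty[OF X False]) (auto simp: \<A>_def)
      moreover have "compactin X (\<Inter>C)"
      proof -
        obtain A0 where A0: "A0 \<in> C" using False by auto
        have "closedin X (\<Inter>C)"
        proof (rule closedin_Inter[OF False])
          fix B assume "B \<in> C"
          with CA have "compactin X B" by (auto simp: \<A>_def)
          with X show "closedin X B" by (rule compactin_imp_closedin)
        qed
        moreover have "compactin X A0" using A0 CA by (auto simp: \<A>_def)
        ultimately show ?thesis using Inter_lower[OF A0] closed_compactin by blast
      qed
      ultimately have "\<Inter>C \<in> \<A>" using CA False unfolding \<A>_def by blast
      then show ?thesis by blast
    qed
  qed
  then obtain M where "M \<in> \<A>" and min: "\<And>A. A \<in> \<A> \<Longrightarrow> A \<subseteq> M \<Longrightarrow> A = M"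
    by blast
  then have M: "M \<subseteq> S" "M \<noteq> {}" "compactin X M" "\<And>x y. x \<in> M \<Longrightarrow> y \<in> M \<Longrightarrow> m x y \<in> M"
    by (auto simp: \<A>_def)
  obtain e where e: "e \<in> M" using M by auto
  have cont': "continuous_map (subtopology X M) X (\<lambda>x. m x e)"
    using continuous_map_from_subtopology_mono[OF cont M(1)] e M(1) by blast
  have topM: "topspace (subtopology X M) = M"
    using compactin_subset_topspace[OF M(3)] by auto
  have "(\<lambda>x. m x e) ` M \<in> \<A>"
  proof -
    have "compactin X ((\<lambda>x. m x e) ` M)"
      using image_compactin[OF _ cont', of M] M(3) by (simp add: compactin_subtopology)
    moreover have "m (m x e) (m y e) \<in> (\<lambda>x. m x e) ` M" if "x \<in> M" "y \<in> M" for x y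
    proof (rule image_eqI)
      show "m (m x e) (m y e) = m (m (m x e) y) e"
        using assoc[of "m x e" y e] that e M by (metis subsetD)
    qed (use that e M in auto)
    moreover have "(\<lambda>x. m x e) ` M \<subseteq> S" using M(1,4) e by blast
    ultimately show ?thesis using M(2) unfolding \<A>_def by auto
  qed
  then have "(\<lambda>x. m x e) ` M = M" using M(4) e by (intro min) auto
  then obtain b where b: "b \<in> M" "m b e = e" using e by (metis (no_types, lifting) imageE)
  define B where "B = {x \<in> M. m x e = e}"
  have "B \<in> \<A>"
  proof -
    have "e \<in> topspace X" using e compactin_subset_topspace[OF M(3)] by blast
    then have "closedin X {e}" using closedin_Hausdorff_sing_eq[OF X] by blast
    then have "closedin (subtopology X M) B"
      using closedin_continuous_map_preimage[OF cont', of "{e}"] unfolding topM by (simp add: B_def)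
    then have "compactin X B"
      using closedin_trans_full[OF _ compactin_imp_closedin[OF X M(3)]] closed_compactin[OF M(3)]
      by (auto simp: B_def)
    moreover have "m (m x y) e = e" if "x \<in> B" "y \<in> B" for x y
      using assoc[of x y e] that e subsetD[OF M(1)] by (simp add: B_def)
    ultimately show ?thesis using b M(1,4) by (auto simp: \<A>_def B_def)
  qed
  then have "B = M" by (rule min) (simp add: B_def)
  then have "m e e = e" using e by (auto simp: B_def)
  with e M(1) show ?thesis using that by blast
qed

text \<open>Total boundedness of A, for the relation R of being close, without committing to a metric.\<close>

definition finitely_coloured :: "'x set \<Rightarrow> ('x \<Rightarrow> 'x \<Rightarrow> bool) \<Rightarrow> bool" where
  "finitely_coloured A R \<longleftrightarrow> (\<exists>c :: 'x \<Rightarrow> nat. finite (c ` A) \<and> (\<forall>x\<in>A. \<forall>y\<in>A. c x = c y \<longrightarrow> R x y))"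

lemma finitely_coloured_mono:
  assumes "finitely_coloured A R" "\<And>x y. x \<in> A \<Longrightarrow> y \<in> A \<Longrightarrow> R x y \<Longrightarrow> Q x y"
  shows "finitely_coloured A Q"
  using assms unfolding finitely_coloured_def by meson

lemma finitely_coloured_cover:
  assumes "finite F" "\<And>x. x \<in> A \<Longrightarrow> \<exists>i\<in>F. x \<in> V i"
    and "\<And>i x y. i \<in> F \<Longrightarrow> x \<in> A \<Longrightarrow> y \<in> A \<Longrightarrow> x \<in> V i \<Longrightarrow> y \<in> V i \<Longrightarrow> R x y"
  shows "finitely_coloured A R"
proof -
  obtain f where f: "\<And>x. x \<in> A \<Longrightarrow> f x \<in> F \<and> x \<in> V (f x)" using assms(2) by metis
  obtain g :: "_ \<Rightarrow> nat" where g: "inj_on g F"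
    using finite_imp_inj_to_nat_seg[OF assms(1)] by blast
  have "finite ((g \<circ> f) ` A)"
    using f by (intro finite_subset[OF _ finite_imageI[OF assms(1), of g]]) auto
  moreover have "R x y" if "x \<in> A" "y \<in> A" "(g \<circ> f) x = (g \<circ> f) y" for x y
  proof -
    have "f x = f y" using that f g by (auto dest: inj_onD)
    with that f show ?thesis by (metis assms(3))
  qed
  ultimately show ?thesis unfolding finitely_coloured_def by blast
qed

lemma finitely_coloured_representatives:
  assumes "finitely_coloured A R"
  obtains B where "finite B" "B \<subseteq> A" "\<And>x. x \<in> A \<Longrightarrow> \<exists>b\<in>B. R x b"
proof -
  obtain c :: "'a \<Rightarrow> nat" where c: "finite (c ` A)" "\<And>x y. x \<in> A \<Longrightarrow> y \<in> A \<Longrightarrow> c x = c y \<Longrightarrow> R x y"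
    using assms unfolding finitely_coloured_def by blast
  have "inv_into A c (c x) \<in> A" "c (inv_into A c (c x)) = c x" if "x \<in> A" for x
    using that by (auto intro: inv_into_into f_inv_into_f)
  then have "\<exists>b\<in>inv_into A c ` c ` A. R x b" if "x \<in> A" for x
    using c(2)[OF that, of "inv_into A c (c x)"] that by (metis imageI)
  moreover have "inv_into A c ` c ` A \<subseteq> A" by (auto intro: inv_into_into)
  ultimately show ?thesis using c(1) by (intro that[of "inv_into A c ` c ` A"]) simp_all
qed

lemma finitely_coloured_ball:
  assumes "finite I" "\<And>i. i \<in> I \<Longrightarrow> finitely_coloured A (R i)"
  shows "finitely_coloured A (\<lambda>x y. \<forall>i\<in>I. R i x y)"
  using assms
proof (induction I)
  case empty
  show ?case unfolding finitely_coloured_def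
    by (intro exI[of _ "\<lambda>_. 0"]) (auto intro: finite_subset[of _ "{0}"])
next
  case (insert j I)
  have "finitely_coloured A (R j)" using insert.prems by simp
  then obtain c :: "'b \<Rightarrow> nat"
    where c: "finite (c ` A)" "\<And>x y. x \<in> A \<Longrightarrow> y \<in> A \<Longrightarrow> c x = c y \<Longrightarrow> R j x y"
    unfolding finitely_coloured_def by blast
  have "finitely_coloured A (\<lambda>x y. \<forall>i\<in>I. R i x y)" using insert.prems by (intro insert.IH) simp
  then obtain d :: "'b \<Rightarrow> nat"
    where d: "finite (d ` A)" "\<And>x y. x \<in> A \<Longrightarrow> y \<in> A \<Longrightarrow> d x = d y \<Longrightarrow> \<forall>i\<in>I. R i x y"
    unfolding finitely_coloured_def by blast
  have "finite ((\<lambda>x. prod_encode (c x, d x)) ` A)"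
    by (rule finite_subset[OF _ finite_imageI[OF finite_cartesian_product[OF c(1) d(1)]], of _ prod_encode]) auto
  then show ?case
    unfolding finitely_coloured_def using c(2) d(2)
    by (intro exI[of _ "\<lambda>x. prod_encode (c x, d x)"]) auto
qed

lemma finitely_coloured_bounded:
  fixes h :: "'x \<Rightarrow> complex"
  assumes "bounded (h ` A)" "e > 0"
  shows "finitely_coloured A (\<lambda>x y. cmod (h x - h y) \<le> e)"
proof -
  have "compact (closure (h ` A))" using assms by (simp add: compact_closure)
  then obtain k where k: "finite k" "closure (h ` A) \<subseteq> (\<Union>x\<in>k. ball x (e/2))"
    using assms(2) unfolding compact_eq_totally_bounded by (meson half_gt_zero)
  show ?thesis
  proof (rule finitely_coloured_cover[OF k(1), of _ "\<lambda>z. h -` ball z (e/2)"])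
    show "\<exists>i\<in>k. x \<in> h -` ball i (e / 2)" if "x \<in> A" for x
      using k(2) closure_subset[of "h ` A"] that by blast
    show "cmod (h x - h y) \<le> e" if "x \<in> h -` ball i (e / 2)" "y \<in> h -` ball i (e / 2)" for i x y
      using that dist_triangle_half_r[of i "h x" e "h y"] by (simp add: dist_norm)
  qed
qed

text \<open>The pigeonhole principle makes one colouring constant along a subsequence;
  diagonalisation handles all of them at once.\<close>

lemma finitely_coloured_subsequence:
  fixes t :: "nat \<Rightarrow> 'x"
  assumes "\<And>n :: nat. finitely_coloured UNIV (R n)"
  obtains \<sigma> where "strict_mono \<sigma>" "\<And>k i j. k < i \<Longrightarrow> k < j \<Longrightarrow> R k (t (\<sigma> i)) (t (\<sigma> j))"
proof -
  obtain c :: "nat \<Rightarrow> 'x \<Rightarrow> nat"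
    where c: "\<And>n. finite (range (c n))" "\<And>n x y. c n x = c n y \<Longrightarrow> R n x y"
    using assms unfolding finitely_coloured_def by (metis UNIV_I)
  interpret subseqs "\<lambda>n s. \<forall>i j. c n (t (s i)) = c n (t (s j))"
  proof
    fix n and s :: "nat \<Rightarrow> nat"
    have "finite ((\<lambda>i. c n (t (s i))) ` UNIV)"
      by (rule finite_subset[OF _ c(1)[of n]]) auto
    then obtain a where inf: "infinite {i. c n (t (s i)) = c n (t (s a))}"
      using pigeonhole_infinite[of UNIV "\<lambda>i. c n (t (s i))"] by auto
    obtain r :: "nat \<Rightarrow> nat" where "strict_mono r" "\<And>i. c n (t (s (r i))) = c n (t (s a))"
      using infinite_enumerate[OF inf] by auto
    then show "\<exists>r' :: nat \<Rightarrow> nat. strict_mono r' \<and> (\<forall>i j. c n (t ((s \<circ> r') i)) = c n (t ((s \<circ> r') j)))"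
      by (intro exI[of _ r]) simp
  qed
  \<comment> \<open>The diagonal sequence meets requirement \<open>k\<close> only from index
    \<open>Suc k\<close> on, whence the strict \<open>k < i\<close> and \<open>k < j\<close> in the
    conclusion.\<close>
  have *: "c k (t (diagseq (Suc k + i))) = c k (t (diagseq (Suc k + j)))" for k i j
    using diagseq_holds[of k] by simp
  show ?thesis
  proof (rule that[OF subseq_diagseq])
    fix k i j :: nat assume "k < i" "k < j"
    then show "R k (t (diagseq i)) (t (diagseq j))"
      using *[of k "i - Suc k" "j - Suc k"] by (intro c(2)) simp
  qed
qed

section \<open>Pointwise topologies on function types\<close>

lemma Hausdorff_euclidean_fun:
  assumes "Hausdorff_space (euclidean :: 'b::topological_space topology)"
  shows "Hausdorff_space (euclidean :: ('a \<Rightarrow> 'b) topology)"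
  using assms by (simp add: Hausdorff_space_product_topology flip: euclidean_product_topology)

text \<open>Tychonoff's theorem, transported from the explicit product topology to the topology of
  the function type.\<close>

lemma compact_Pi_UNIV:
  assumes "\<And>i. compact (S i)"
  shows "compact {f :: 'a \<Rightarrow> 'b::topological_space. \<forall>i. f i \<in> S i}"
proof -
  have "compactin (product_topology (\<lambda>_. euclidean) UNIV) (Pi\<^sub>E UNIV S)"
    using assms unfolding compactin_PiE by simp
  moreover have "Pi\<^sub>E UNIV S = {f. \<forall>i. f i \<in> S i}" by (auto simp: PiE_iff)
  ultimately show ?thesis by (simp only: euclidean_product_topology compactin_euclidean_iff)
qed

text \<open>Sequences suffice although the space need not be first countable: if no neighbourhood
  given by the first \<open>k + 1\<close> coordinates and tolerance \<open>1/(k+1)\<close> worked, a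
  counterexample for each \<open>k\<close> would form a sequence converging in every
  \<open>e n\<close> while \<open>p\<close> stays away from its limit value.\<close>

lemma continuous_on_countably_many_coordinates:
  fixes p :: "'b::topological_space \<Rightarrow> complex" and e :: "nat \<Rightarrow> 'b \<Rightarrow> complex"
  assumes cont: "\<And>n. continuous_on S (e n)"
    and seq: "\<And>x l. (\<And>k. x k \<in> S) \<Longrightarrow> l \<in> S \<Longrightarrow> (\<And>n. (\<lambda>k. e n (x k)) \<longlonglongrightarrow> e n l) \<Longrightarrow> (\<lambda>k. p (x k)) \<longlonglongrightarrow> p l"
  shows "continuous_on S p"
  unfolding continuous_on_def
proof (intro ballI tendstoI)
  fix l and \<epsilon> :: real assume l: "l \<in> S" and \<epsilon>: "\<epsilon> > 0"
  have "\<exists>k. \<forall>x\<in>S. (\<forall>n\<le>k. dist (e n x) (e n l) < inverse (Suc k)) \<longrightarrow> dist (p x) (p l) < \<epsilon>"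
  proof (rule ccontr)
    assume "\<not> ?thesis"
    then obtain x where x: "\<And>k. x k \<in> S" "\<And>k n. n \<le> k \<Longrightarrow> dist (e n (x k)) (e n l) < inverse (Suc k)"
      "\<And>k. \<not> dist (p (x k)) (p l) < \<epsilon>"
      by metis
    have "(\<lambda>k. e n (x k)) \<longlonglongrightarrow> e n l" for n
    proof (rule metric_tendsto_imp_tendsto[OF LIMSEQ_inverse_real_of_nat])
      show "\<forall>\<^sub>F k in sequentially. dist (e n (x k)) (e n l) \<le> dist (inverse (real (Suc k))) 0"
        using eventually_ge_at_top[of n]
      proof eventually_elim
        case (elim k)
        from x(2)[OF elim] show ?case by (simp add: dist_real_def)
      qed
    qed
    then have "(\<lambda>k. p (x k)) \<longlonglongrightarrow> p l" by (rule seq[OF x(1) l])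
    then have "\<forall>\<^sub>F k in sequentially. dist (p (x k)) (p l) < \<epsilon>" using \<epsilon> by (rule tendstoD)
    with x(3) show False by (simp add: eventually_sequentially)
  qed
  then obtain k where k: "\<And>x. x \<in> S \<Longrightarrow> (\<And>n. n \<le> k \<Longrightarrow> dist (e n x) (e n l) < inverse (Suc k)) \<Longrightarrow> dist (p x) (p l) < \<epsilon>"
    by blast
  have "\<forall>\<^sub>F x in at l within S. \<forall>n\<in>{..k}. dist (e n x) (e n l) < inverse (Suc k)"
    using cont l by (intro eventually_ball_finite ballI tendstoD) (auto simp: continuous_on_def)
  moreover have "\<forall>\<^sub>F x in at l within S. x \<in> S" by (simp add: eventually_at_filter)
  ultimately show "\<forall>\<^sub>F x in at l within S. dist (p x) (p l) < \<epsilon>"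
    by eventually_elim (auto intro: k)
qed

section \<open>Dual, bidual and weakly almost periodic functions\<close>

lemma cdual_bounded_linear: "\<phi> \<in> cdual J \<Longrightarrow> bounded_linear \<phi>"
  by (simp add: cdual_def)

lemma cdual_zero: "(\<lambda>x. 0) \<in> cdual J"
  by (simp add: cdual_def bounded_linear_zero)

lemma cdual_scale: "\<phi> \<in> cdual J \<Longrightarrow> (\<lambda>x. c * \<phi> x) \<in> cdual J"
  by (auto simp: cdual_def bounded_linear_const_mult algebra_simps)

lemma cdual_diff: "\<phi> \<in> cdual J \<Longrightarrow> \<psi> \<in> cdual J \<Longrightarrow> (\<lambda>x. \<phi> x - \<psi> x) \<in> cdual J"
  by (auto simp: cdual_def bounded_linear_sub algebra_simps)

lemma dnorm_nonneg: "\<phi> \<in> cdual J \<Longrightarrow> 0 \<le> dnorm \<phi>"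
  by (simp add: dnorm_def onorm_pos_le cdual_bounded_linear)

lemma dnorm_scale: "\<phi> \<in> cdual J \<Longrightarrow> dnorm (\<lambda>x. complex_of_real c * \<phi> x) = \<bar>c\<bar> * dnorm \<phi>"
  using onorm_scaleR[OF cdual_bounded_linear, of \<phi> J c]
  by (simp add: dnorm_def scaleR_conv_of_real)

lemma dnorm_triangle_diff:
  assumes "\<phi> \<in> cdual J" "\<psi> \<in> cdual J"
  shows "\<bar>dnorm \<phi> - dnorm \<psi>\<bar> \<le> dnorm (\<lambda>x. \<phi> x - \<psi> x)"
proof -
  have bl: "bounded_linear \<phi>" "bounded_linear \<psi>" using assms by (auto simp: cdual_def)
  have "onorm \<phi> \<le> onorm (\<lambda>x. \<phi> x - \<psi> x) + onorm \<psi>"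
    using onorm_triangle[OF bounded_linear_sub[OF bl] bl(2)] by simp
  moreover have "onorm \<psi> \<le> onorm (\<lambda>x. \<psi> x - \<phi> x) + onorm \<phi>"
    using onorm_triangle[OF bounded_linear_sub[OF bl(2,1)] bl(1)] by simp
  moreover have "onorm (\<lambda>x. \<psi> x - \<phi> x) = onorm (\<lambda>x. \<phi> x - \<psi> x)"
    using onorm_neg[of "\<lambda>x. \<phi> x - \<psi> x"] by simp
  ultimately show ?thesis by (simp add: dnorm_def)
qed

lemma dual_ball_cdual: "\<phi> \<in> dual_ball J \<Longrightarrow> \<phi> \<in> cdual J"
  by (simp add: dual_ball_def)

lemma dual_ball_zero: "(\<lambda>x. 0) \<in> dual_ball J"
  by (simp add: dual_ball_def cdual_zero dnorm_def onorm_zero)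

lemma bidual_scale: "\<xi> \<in> bidual J \<Longrightarrow> \<phi> \<in> cdual J \<Longrightarrow> \<xi> (\<lambda>x. c * \<phi> x) = c * \<xi> \<phi>"
  by (simp add: bidual_def)

lemma bidual_add:
  "\<xi> \<in> bidual J \<Longrightarrow> \<phi> \<in> cdual J \<Longrightarrow> \<psi> \<in> cdual J \<Longrightarrow> \<xi> (\<lambda>x. \<phi> x + \<psi> x) = \<xi> \<phi> + \<xi> \<psi>"
  by (simp add: bidual_def)

lemma bidual_zero: "\<xi> \<in> bidual J \<Longrightarrow> \<xi> (\<lambda>x. 0) = 0"
  using bidual_scale[of \<xi> J "\<lambda>x. 0" 0] cdual_zero[of J] by simp

lemma bidual_outside: "\<xi> \<in> bidual J \<Longrightarrow> \<phi> \<notin> cdual J \<Longrightarrow> \<xi> \<phi> = 0"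
  by (simp add: bidual_def)

lemma bidual_minus:
  assumes "\<xi> \<in> bidual J" "\<phi> \<in> cdual J" "\<psi> \<in> cdual J"
  shows "\<xi> (\<lambda>x. \<phi> x - \<psi> x) = \<xi> \<phi> - \<xi> \<psi>"
proof -
  have "\<xi> (\<lambda>x. \<phi> x + (- 1) * \<psi> x) = \<xi> \<phi> + \<xi> (\<lambda>x. (- 1) * \<psi> x)"
    by (rule bidual_add[OF assms(1,2) cdual_scale[OF assms(3)]])
  also have "\<xi> (\<lambda>x. (- 1) * \<psi> x) = - \<xi> \<psi>"
    using bidual_scale[OF assms(1,3), of "- 1"] by simp
  finally show ?thesis by simp
qed

lemma bidual_diff:
  assumes "\<xi> \<in> bidual J" "\<eta> \<in> bidual J"
  shows "(\<lambda>\<phi>. \<xi> \<phi> - \<eta> \<phi>) \<in> bidual J"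
proof -
  obtain K where K: "\<And>\<phi>. \<phi> \<in> cdual J \<Longrightarrow> cmod (\<xi> \<phi>) \<le> K * dnorm \<phi>"
    using assms(1) unfolding bidual_def by blast
  obtain L where L: "\<And>\<phi>. \<phi> \<in> cdual J \<Longrightarrow> cmod (\<eta> \<phi>) \<le> L * dnorm \<phi>"
    using assms(2) unfolding bidual_def by blast
  have "cmod (\<xi> \<phi> - \<eta> \<phi>) \<le> (K + L) * dnorm \<phi>" if "\<phi> \<in> cdual J" for \<phi>
    using norm_triangle_ineq4[of "\<xi> \<phi>" "\<eta> \<phi>"] K[OF that] L[OF that] by (simp add: algebra_simps)
  then have "\<exists>K. \<forall>\<phi>\<in>cdual J. cmod (\<xi> \<phi> - \<eta> \<phi>) \<le> K * dnorm \<phi>" by blast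
  then show ?thesis
    using assms unfolding bidual_def by (simp add: algebra_simps)
qed

lemma bnorm_le: "(\<And>\<phi>. \<phi> \<in> dual_ball J \<Longrightarrow> cmod (\<xi> \<phi>) \<le> e) \<Longrightarrow> bnorm J \<xi> \<le> e"
  unfolding bnorm_def using dual_ball_zero by (intro cSUP_least) auto

lemma bdist_le: "(\<And>\<phi>. \<phi> \<in> dual_ball J \<Longrightarrow> cmod (\<xi> \<phi> - \<eta> \<phi>) \<le> e) \<Longrightarrow> bdist J \<xi> \<eta> \<le> e"
  unfolding bdist_def by (rule bnorm_le)

lemma bnorm_upper:
  assumes "\<xi> \<in> bidual J" "\<phi> \<in> dual_ball J"
  shows "cmod (\<xi> \<phi>) \<le> bnorm J \<xi>"
  unfolding bnorm_def
proof (rule cSUP_upper[OF assms(2)])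
  obtain K where K: "\<And>\<phi>. \<phi> \<in> cdual J \<Longrightarrow> cmod (\<xi> \<phi>) \<le> K * dnorm \<phi>"
    using assms(1) unfolding bidual_def by blast
  show "bdd_above ((\<lambda>\<phi>. cmod (\<xi> \<phi>)) ` dual_ball J)"
  proof (rule bdd_aboveI2)
    fix \<phi> assume "\<phi> \<in> dual_ball J"
    then have \<phi>: "\<phi> \<in> cdual J" "dnorm \<phi> \<le> 1" "0 \<le> dnorm \<phi>"
      using dnorm_nonneg by (auto simp: dual_ball_def)
    have "K * dnorm \<phi> \<le> \<bar>K\<bar> * dnorm \<phi>" using \<phi> by (intro mult_right_mono) auto
    also have "\<dots> \<le> \<bar>K\<bar> * 1" using \<phi> by (intro mult_left_mono) auto
    finally show "cmod (\<xi> \<phi>) \<le> \<bar>K\<bar>" using K[OF \<phi>(1)] by simp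
  qed
qed

lemma bnorm_bound:
  assumes \<xi>: "\<xi> \<in> bidual J" and \<phi>: "\<phi> \<in> cdual J"
  shows "cmod (\<xi> \<phi>) \<le> bnorm J \<xi> * dnorm \<phi>"
proof (cases "dnorm \<phi> = 0")
  case True
  then show ?thesis using \<xi> \<phi> unfolding bidual_def by force
next
  case False
  with dnorm_nonneg[OF \<phi>] have pos: "0 < dnorm \<phi>" by simp
  let ?\<psi> = "\<lambda>x. complex_of_real (inverse (dnorm \<phi>)) * \<phi> x"
  have "?\<psi> \<in> dual_ball J"
    using dnorm_scale[OF \<phi>, of "inverse (dnorm \<phi>)"] cdual_scale[OF \<phi>] pos
    by (simp add: dual_ball_def)
  from bnorm_upper[OF \<xi> this] show ?thesis
    unfolding bidual_scale[OF \<xi> \<phi>] using pos by (simp add: norm_mult norm_divide field_simps)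
qed

lemma bdist_bound:
  assumes "\<xi> \<in> bidual J" "\<eta> \<in> bidual J" "\<phi> \<in> cdual J"
  shows "cmod (\<xi> \<phi> - \<eta> \<phi>) \<le> bdist J \<xi> \<eta> * dnorm \<phi>"
  unfolding bdist_def using bnorm_bound[OF bidual_diff[OF assms(1,2)] assms(3)] by simp

text \<open>Bounds stated separately for each functional, here and for the modulus of continuity,
  are closed conditions for pointwise convergence and so pass to orbit closures;
  \<open>BUC_I\<close> converts them back to norms.\<close>

lemma BUC_bound:
  assumes "f \<in> BUC J"
  obtains B where "\<And>r \<phi>. \<phi> \<in> cdual J \<Longrightarrow> cmod (f r \<phi>) \<le> B * dnorm \<phi>"
proof -
  obtain B where B: "\<And>r. f r \<in> bidual J" "\<And>r. bnorm J (f r) \<le> B"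
    using assms unfolding BUC_def by blast
  have "cmod (f r \<phi>) \<le> B * dnorm \<phi>" if "\<phi> \<in> cdual J" for r \<phi>
    using bnorm_bound[OF B(1) that, of r] mult_right_mono[OF B(2)[of r] dnorm_nonneg[OF that]] by simp
  then show ?thesis using that by blast
qed

lemma BUC_modulus:
  assumes "f \<in> BUC J" "e > 0"
  obtains d where "d > 0"
    "\<And>r s \<phi>. \<bar>r - s\<bar> < d \<Longrightarrow> \<phi> \<in> cdual J \<Longrightarrow> cmod (f r \<phi> - f s \<phi>) \<le> e * dnorm \<phi>"
proof -
  have f: "\<And>r. f r \<in> bidual J" using assms by (simp add: BUC_def)
  obtain d where d: "d > 0" "\<And>r s. \<bar>r - s\<bar> < d \<Longrightarrow> bdist J (f r) (f s) < e"
    using assms unfolding BUC_def by blast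
  have "cmod (f r \<phi> - f s \<phi>) \<le> e * dnorm \<phi>" if "\<bar>r - s\<bar> < d" "\<phi> \<in> cdual J" for r s \<phi>
    using bdist_bound[OF f f that(2), of r s]
      mult_right_mono[OF less_imp_le[OF d(2)[OF that(1)]] dnorm_nonneg[OF that(2)]] by simp
  then show ?thesis using that d(1) by blast
qed

lemma BUC_I:
  assumes "\<And>r. f r \<in> bidual J" "\<And>r \<phi>. \<phi> \<in> cdual J \<Longrightarrow> cmod (f r \<phi>) \<le> B * dnorm \<phi>"
    and mod: "\<And>e. e > 0 \<Longrightarrow> \<exists>d>0. \<forall>r s \<phi>. \<bar>r - s\<bar> < d \<longrightarrow> \<phi> \<in> cdual J \<longrightarrow> cmod (f r \<phi> - f s \<phi>) \<le> e * dnorm \<phi>"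
  shows "f \<in> BUC J"
proof -
  have le: "c * dnorm \<phi> \<le> \<bar>c\<bar>" if "\<phi> \<in> dual_ball J" for c \<phi>
  proof -
    have \<phi>: "dnorm \<phi> \<le> 1" "0 \<le> dnorm \<phi>" using that dnorm_nonneg by (auto simp: dual_ball_def)
    have "c * dnorm \<phi> \<le> \<bar>c\<bar> * dnorm \<phi>" using \<phi> by (intro mult_right_mono) auto
    also have "\<dots> \<le> \<bar>c\<bar> * 1" using \<phi> by (intro mult_left_mono) auto
    finally show ?thesis by simp
  qed
  have "bnorm J (f r) \<le> \<bar>B\<bar>" for r
    by (intro bnorm_le order_trans[OF assms(2) le] dual_ball_cdual)
  moreover have "\<exists>d>0. \<forall>r s. \<bar>r - s\<bar> < d \<longrightarrow> bdist J (f r) (f s) < e" if e: "e > 0" for e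
  proof -
    \<comment> \<open>\<open>e/2\<close> recovers the strict inequality demanded by
      \<open>BUC\<close> from the weak one.\<close>
    obtain d where d: "d > 0" "\<And>r s \<phi>. \<bar>r - s\<bar> < d \<Longrightarrow> \<phi> \<in> cdual J \<Longrightarrow> cmod (f r \<phi> - f s \<phi>) \<le> e/2 * dnorm \<phi>"
      using mod[of "e/2"] e by auto
    have "bdist J (f r) (f s) < e" if "\<bar>r - s\<bar> < d" for r s
    proof -
      have "bdist J (f r) (f s) \<le> \<bar>e/2\<bar>"
        by (intro bdist_le order_trans[OF d(2)[OF that] le] dual_ball_cdual)
      also have "\<dots> < e" using e by simp
      finally show ?thesis .
    qed
    then show ?thesis using d(1) by blast
  qed
  ultimately show ?thesis using assms(1) unfolding BUC_def by blast
qed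

section \<open>The weak topology of bounded continuous functions and pointwise orbit
  closures\<close>

lemma topspace_weak_Cb: "topspace weak_Cb = UNIV"
proof -
  have "(\<lambda>x::real \<Rightarrow>\<^sub>C complex. 0::complex) -` UNIV \<in> {L -` U | L U. bounded_linear L \<and> open (U::complex set)}"
    using bounded_linear_zero open_UNIV by blast
  then show ?thesis unfolding weak_Cb_def topology_generated_by_topspace by auto
qed

lemma openin_weak_Cb: "bounded_linear L \<Longrightarrow> open U \<Longrightarrow> openin weak_Cb (L -` (U::complex set))"
  unfolding weak_Cb_def by (rule topology_generated_by_Basis) blast

lemma bounded_linear_apply_bcontfun: "bounded_linear (\<lambda>k::real \<Rightarrow>\<^sub>C complex. apply_bcontfun k r)"
  by (rule bounded_linear_intro[where K = 1]) (auto simp: norm_bounded)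

lemma continuous_map_weak_Cb_pointwise: "continuous_map weak_Cb euclidean apply_bcontfun"
proof -
  have "continuous_map weak_Cb euclidean (\<lambda>k. apply_bcontfun k r)" for r
    unfolding continuous_map_def
    using openin_weak_Cb[OF bounded_linear_apply_bcontfun[of r]] by (simp add: topspace_weak_Cb vimage_def)
  then show ?thesis
    by (simp add: continuous_map_componentwise_UNIV flip: euclidean_product_topology)
qed

text \<open>Closures of this set are taken in the topology of the function type, so they are
  pointwise orbit closures; for bidual-valued functions this means pointwise in the time and in the
  functional.\<close>

abbreviation translates :: "(real \<Rightarrow> 'b) \<Rightarrow> (real \<Rightarrow> 'b) set" where
  "translates g \<equiv> range (\<lambda>t r. g (r + t))"

lemma closure_translates_shift:
  fixes g :: "real \<Rightarrow> 'b::topological_space"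
  assumes "h \<in> closure (translates g)"
  shows "(\<lambda>r. h (r + t)) \<in> closure (translates g)"
proof -
  have "continuous_on (closure (translates g)) (\<lambda>(h::real \<Rightarrow> 'b) r. h (r + t))"
    by (intro continuous_on_coordinatewise_then_product)
      (rule continuous_on_product_then_coordinatewise[OF continuous_on_id])
  moreover have "(\<lambda>(h::real \<Rightarrow> 'b) r. h (r + t)) ` translates g \<subseteq> closure (translates g)"
  proof -
    have "(\<lambda>r. g (r + t + u)) \<in> translates g" for u
      by (rule range_eqI[of _ _ "t + u"]) (simp add: add.assoc)
    then show ?thesis using closure_subset[of "translates g"] by blast
  qed
  ultimately show ?thesis using image_closure_subset[OF _ closed_closure] assms by blast
qed

lemma Wfun_shift_bcontfun:
  assumes "g \<in> Wfun"
  shows "(\<lambda>r. g (r + t)) \<in> bcontfun"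
proof -
  have "continuous_on UNIV (\<lambda>r. g (r + t))"
    using assms continuous_on_compose2[of UNIV g UNIV "\<lambda>r. r + t"]
    by (simp add: Wfun_def continuous_on_add)
  moreover have "bounded (range (\<lambda>r. g (r + t)))"
    using assms by (auto simp: Wfun_def intro: bounded_subset[of "range g"])
  ultimately show ?thesis by (simp add: bcontfun_def)
qed

text \<open>Evaluations are weakly continuous, so the weakly compact closure is also pointwise
  compact and hence pointwise closed. Pointwise limits of translates are therefore already weak
  closure points, in particular bounded and continuous.\<close>

lemma Wfun_pointwise_closure:
  assumes g: "g \<in> Wfun" and h: "h \<in> closure (translates g)"
  shows "h \<in> apply_bcontfun ` (weak_Cb closure_of {Bcontfun (\<lambda>r. g (r + t)) | t. True})"
proof -
  let ?K = "weak_Cb closure_of {Bcontfun (\<lambda>r. g (r + t)) | t. True}"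
  have "compactin euclidean (apply_bcontfun ` ?K)"
    using g image_compactin[OF _ continuous_map_weak_Cb_pointwise] by (auto simp: Wfun_def)
  then have "closedin euclidean (apply_bcontfun ` ?K)"
    by (intro compactin_imp_closedin Hausdorff_euclidean_fun) auto
  then have "closed (apply_bcontfun ` ?K)" by (simp only: closed_closedin)
  moreover have "(\<lambda>r. g (r + t)) \<in> apply_bcontfun ` ?K" for t
  proof (rule image_eqI)
    show "(\<lambda>r. g (r + t)) = apply_bcontfun (Bcontfun (\<lambda>r. g (r + t)))"
      by (simp add: Bcontfun_inverse Wfun_shift_bcontfun[OF g])
    show "Bcontfun (\<lambda>r. g (r + t)) \<in> ?K"
      by (rule subsetD[OF closure_of_subset]) (auto simp: topspace_weak_Cb)
  qed
  ultimately have "closure (translates g) \<subseteq> apply_bcontfun ` ?K"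
    by (intro closure_minimal) auto
  with h show ?thesis by blast
qed

text \<open>All translates of \<open>h\<close> stay in the weakly compact set belonging to
  \<open>g\<close>, so their weak closure is a closed subset of it.\<close>

lemma Wfun_pointwise_closure_Wfun:
  assumes g: "g \<in> Wfun" and h: "h \<in> closure (translates g)"
  shows "h \<in> Wfun"
proof -
  let ?K = "weak_Cb closure_of {Bcontfun (\<lambda>r. g (r + t)) | t. True}"
  have K: "compactin weak_Cb ?K" using g by (simp add: Wfun_def)
  have "Bcontfun (\<lambda>r. h (r + t)) \<in> ?K" for t
    using Wfun_pointwise_closure[OF g closure_translates_shift[OF h, of t]] 
    by (auto simp: apply_bcontfun_inverse)
  then have "weak_Cb closure_of {Bcontfun (\<lambda>r. h (r + t)) | t. True} \<subseteq> ?K"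
    by (intro closure_of_minimal closedin_closure_of) auto
  then have "compactin weak_Cb (weak_Cb closure_of {Bcontfun (\<lambda>r. h (r + t)) | t. True})"
    using closed_compactin[OF K] closedin_closure_of by blast
  moreover have "continuous_on UNIV h" "bounded (range h)"
    using Wfun_pointwise_closure[OF g h] by auto
  ultimately show ?thesis by (simp add: Wfun_def)
qed

text \<open>A closed subspace is weakly closed, so the weak closure of the translates stays in the
  norm-separable space spanned by the rational translates.\<close>

lemma Wfun_separable:
  assumes g: "g \<in> Wfun" and uc: "uniformly_continuous_on UNIV g"
  obtains D :: "(real \<Rightarrow> complex) set" where "countable D"
    "\<And>h e. h \<in> closure (translates g) \<Longrightarrow> e > 0 \<Longrightarrow> \<exists>d\<in>D. \<forall>r. cmod (h r - d r) \<le> e"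
proof -
  let ?A = "{Bcontfun (\<lambda>r. g (r + t)) | t. True}"
  define T where "T t = Bcontfun (\<lambda>r. g (r + t))" for t
  have T: "apply_bcontfun (T t) = (\<lambda>r. g (r + t))" for t
    by (simp add: T_def Bcontfun_inverse Wfun_shift_bcontfun[OF g])
  obtain q :: "nat \<Rightarrow> real" where q: "range q = \<rat>"
    using range_from_nat_into[OF _ countable_rat] by (metis Rats_0 empty_iff)
  obtain D where D: "countable D" "subspace (closure D)" "range (\<lambda>n. T (q n)) \<subseteq> D"
    using countable_dense_in_closed_subspace by blast
  \<comment> \<open>Uniform continuity brings every translate within \<open>e/2\<close> of a
    rational one in sup norm.\<close>
  have TD: "T t \<in> closure D" for t
    unfolding closure_approachable
  proof (intro allI impI)
    fix e :: real assume e: "e > 0"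
    obtain \<delta> where \<delta>: "\<delta> > 0" "\<And>x y. dist x y < \<delta> \<Longrightarrow> dist (g x) (g y) < e/2"
      using uc e unfolding uniformly_continuous_on_def by (metis UNIV_I half_gt_zero dist_commute)
    obtain n where n: "dist (q n) t < \<delta>"
      using Rats_closure_real \<delta>(1) q by (metis UNIV_I closure_approachable rangeE)
    have "dist (T (q n)) (T t) \<le> e/2"
    proof (rule dist_bound)
      fix r
      have "dist (r + q n) (r + t) < \<delta>" using n by (simp add: dist_real_def)
      then show "dist (apply_bcontfun (T (q n)) r) (apply_bcontfun (T t) r) \<le> e/2"
        using \<delta>(2) by (simp add: T less_imp_le)
    qed
    then show "\<exists>y\<in>D. dist y (T t) < e"
      using D(3) e by (intro bexI[of _ "T (q n)"]) auto
  qed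
  have K: "weak_Cb closure_of ?A \<subseteq> closure D"
  proof (rule ccontr)
    assume "\<not> ?thesis"
    then obtain k where k: "k \<in> weak_Cb closure_of ?A" "k \<notin> closure D" by blast
    obtain L :: "(real \<Rightarrow>\<^sub>C complex) \<Rightarrow> real"
      where L: "bounded_linear L" "\<And>y. y \<in> closure D \<Longrightarrow> L y = 0" "L k \<noteq> 0"
      using Hahn_Banach_closed_subspace[OF D(2) closed_closure k(2)] by blast
    \<comment> \<open>\<open>weak_Cb\<close> is generated by complex-valued functionals, so the real
      \<open>L\<close> is followed by the embedding of the reals.\<close>
    have "bounded_linear (\<lambda>x. complex_of_real (L x))"
      using bounded_linear_compose[OF bounded_linear_of_real L(1)] .
    then have "openin weak_Cb ((\<lambda>x. complex_of_real (L x)) -` (- {0}))"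
      by (rule openin_weak_Cb) auto
    moreover have "k \<in> (\<lambda>x. complex_of_real (L x)) -` (- {0})" using L(3) by simp
    ultimately obtain y where y: "y \<in> ?A" "y \<in> (\<lambda>x. complex_of_real (L x)) -` (- {0})"
      using k(1) unfolding in_closure_of by meson
    then obtain t where "y = T t" by (auto simp: T_def)
    with y(2) L(2)[OF TD[of t]] show False by simp
  qed
  show ?thesis
  proof (rule that[of "apply_bcontfun ` D"])
    fix h :: "real \<Rightarrow> complex" and e :: real
    assume h: "h \<in> closure (translates g)" and e: "e > 0"
    obtain k where k: "k \<in> closure D" "h = apply_bcontfun k"
      using Wfun_pointwise_closure[OF g h] K by blast
    then obtain d where "d \<in> D" "dist d k < e"
      using e unfolding closure_approachable by blast
    then have "cmod (h r - apply_bcontfun d r) \<le> e" for r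
      using dist_bounded[of d r k] k(2) by (simp add: dist_norm norm_minus_commute)
    then show "\<exists>d\<in>apply_bcontfun ` D. \<forall>r. cmod (h r - d r) \<le> e"
      using \<open>d \<in> D\<close> by blast
  qed (use D(1) in simp)
qed

section \<open>Orbit closures and the pairing with L1\<close>

lemma continuous_on_eval: "continuous_on S (\<lambda>h :: real \<Rightarrow> 'b \<Rightarrow> 'c::topological_space. h r \<phi>)"
  by (rule continuous_on_product_then_coordinatewise[OF
      continuous_on_product_then_coordinatewise[OF continuous_on_id]])

lemma closure_translates_induct:
  fixes f :: "real \<Rightarrow> 'b::topological_space"
  assumes "h \<in> closure (translates f)" "closed {h. Q h}" "\<And>t. Q (\<lambda>r. f (r + t))"
  shows "Q h"
proof -
  have "closure (translates f) \<subseteq> {h. Q h}" using assms(2,3) by (intro closure_minimal) auto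
  with assms(1) show ?thesis by auto
qed

lemma closure_translates_bound:
  assumes "h \<in> closure (translates f)" "\<And>r \<phi>. \<phi> \<in> cdual J \<Longrightarrow> cmod (f r \<phi>) \<le> B * dnorm \<phi>" "\<phi> \<in> cdual J"
  shows "cmod (h r \<phi>) \<le> B * dnorm \<phi>"
  using assms
  by (intro closure_translates_induct[OF assms(1), of "\<lambda>h. cmod (h r \<phi>) \<le> B * dnorm \<phi>"]
      closed_Collect_le continuous_on_norm continuous_on_eval continuous_on_const) auto

lemma closure_translates_modulus:
  assumes "h \<in> closure (translates f)"
    "\<And>r s \<phi>. \<bar>r - s\<bar> < d \<Longrightarrow> \<phi> \<in> cdual J \<Longrightarrow> cmod (f r \<phi> - f s \<phi>) \<le> e * dnorm \<phi>"
    "\<phi> \<in> cdual J" "\<bar>r - s\<bar> < d"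
  shows "cmod (h r \<phi> - h s \<phi>) \<le> e * dnorm \<phi>"
  using assms
  by (intro closure_translates_induct[OF assms(1), of "\<lambda>h. cmod (h r \<phi> - h s \<phi>) \<le> e * dnorm \<phi>"]
      closed_Collect_le continuous_on_norm continuous_on_diff continuous_on_eval continuous_on_const) auto

lemma closure_translates_bidual:
  assumes f: "f \<in> BUC J" and h: "h \<in> closure (translates f)"
  shows "h r \<in> bidual J"
proof -
  have fb: "\<And>r. f r \<in> bidual J" using f by (simp add: BUC_def)
  have "h r (\<lambda>x. \<phi> x + \<psi> x) = h r \<phi> + h r \<psi>" if "\<phi> \<in> cdual J" "\<psi> \<in> cdual J" for \<phi> \<psi>
    by (intro closure_translates_induct[OF h, of "\<lambda>h. h r (\<lambda>x. \<phi> x + \<psi> x) = h r \<phi> + h r \<psi>"]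
        closed_Collect_eq continuous_on_add continuous_on_eval bidual_add[OF fb] that)
  moreover have "h r (\<lambda>x. c * \<phi> x) = c * h r \<phi>" if "\<phi> \<in> cdual J" for \<phi> c
    by (intro closure_translates_induct[OF h, of "\<lambda>h. h r (\<lambda>x. c * \<phi> x) = c * h r \<phi>"]
        closed_Collect_eq continuous_on_mult continuous_on_const continuous_on_eval bidual_scale[OF fb] that)
  moreover have "h r \<phi> = 0" if "\<phi> \<notin> cdual J" for \<phi>
    by (intro closure_translates_induct[OF h, of "\<lambda>h. h r \<phi> = 0"]
        closed_Collect_eq continuous_on_const continuous_on_eval bidual_outside[OF fb that])
  moreover obtain B where "\<And>r \<phi>. \<phi> \<in> cdual J \<Longrightarrow> cmod (f r \<phi>) \<le> B * dnorm \<phi>"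
    using BUC_bound[OF f] by metis
  then have "\<forall>\<phi>\<in>cdual J. cmod (h r \<phi>) \<le> B * dnorm \<phi>"
    using closure_translates_bound[OF h] by blast
  ultimately show ?thesis unfolding bidual_def by blast
qed

lemma closure_translates_BUC:
  assumes f: "f \<in> BUC J" and h: "h \<in> closure (translates f)"
  shows "h \<in> BUC J"
proof -
  obtain B where "\<And>r \<phi>. \<phi> \<in> cdual J \<Longrightarrow> cmod (f r \<phi>) \<le> B * dnorm \<phi>"
    using BUC_bound[OF f] by metis
  then have "cmod (h r \<phi>) \<le> B * dnorm \<phi>" if "\<phi> \<in> cdual J" for r \<phi>
    using closure_translates_bound[OF h] that by blast
  moreover have "\<exists>d>0. \<forall>r s \<phi>. \<bar>r - s\<bar> < d \<longrightarrow> \<phi> \<in> cdual J \<longrightarrow> cmod (h r \<phi> - h s \<phi>) \<le> e * dnorm \<phi>"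
    if "e > 0" for e
  proof -
    obtain d where "d > 0"
      "\<And>r s \<phi>. \<bar>r - s\<bar> < d \<Longrightarrow> \<phi> \<in> cdual J \<Longrightarrow> cmod (f r \<phi> - f s \<phi>) \<le> e * dnorm \<phi>"
      using BUC_modulus[OF f \<open>e > 0\<close>] by metis
    then show ?thesis using closure_translates_modulus[OF h] by blast
  qed
  ultimately show ?thesis using closure_translates_bidual[OF f h] by (intro BUC_I) auto
qed

lemma closure_translates_slice:
  fixes f :: "real \<Rightarrow> 'b \<Rightarrow> 'c::topological_space"
  assumes "h \<in> closure (translates f)"
  shows "(\<lambda>r. h r \<phi>) \<in> closure (translates (\<lambda>r. f r \<phi>))"
proof -
  have "continuous_on (closure (translates f)) (\<lambda>(h :: real \<Rightarrow> 'b \<Rightarrow> 'c) r. h r \<phi>)"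
    by (intro continuous_on_coordinatewise_then_product continuous_on_eval)
  moreover have "(\<lambda>(h :: real \<Rightarrow> 'b \<Rightarrow> 'c) r. h r \<phi>) ` translates f \<subseteq> closure (translates (\<lambda>r. f r \<phi>))"
    using closure_subset[of "translates (\<lambda>r. f r \<phi>)"] by blast
  ultimately show ?thesis using image_closure_subset[OF _ closed_closure] assms by blast
qed

lemma closure_translates_WW:
  assumes "f \<in> WW J" "h \<in> closure (translates f)"
  shows "h \<in> WW J"
proof -
  have "(\<lambda>r. h r \<phi>) \<in> Wfun" if "\<phi> \<in> cdual J" for \<phi>
    using assms(1) that
    by (intro Wfun_pointwise_closure_Wfun[OF _ closure_translates_slice[OF assms(2)]]) (simp add: WW_def)
  moreover have "h \<in> BUC J"
    using assms(1) by (intro closure_translates_BUC[OF _ assms(2)]) (simp add: WW_def)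
  ultimately show ?thesis by (simp add: WW_def)
qed

text \<open>The orbit closure is a closed subset of a product of discs. Outside
  \<open>cdual J\<close> the radius is 0, since bidual elements vanish there by the extensional
  encoding.\<close>

lemma compact_closure_translates:
  assumes f: "f \<in> BUC J"
  shows "compact (closure (translates f))"
proof -
  obtain B where B: "\<And>r \<phi>. \<phi> \<in> cdual J \<Longrightarrow> cmod (f r \<phi>) \<le> B * dnorm \<phi>"
    using BUC_bound[OF f] by metis
  define b where "b \<phi> = (if \<phi> \<in> cdual J then B * dnorm \<phi> else 0)" for \<phi>
  let ?C = "{h :: real \<Rightarrow> 'a bidualv. \<forall>r. h r \<in> {\<xi>. \<forall>\<phi>. \<xi> \<phi> \<in> cball 0 (b \<phi>)}}"
  have "closure (translates f) \<subseteq> ?C"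
    using closure_translates_bound[OF _ B] bidual_outside[OF closure_translates_bidual[OF f]]
    by (auto simp: b_def)
  moreover have "compact ?C" by (intro compact_Pi_UNIV compact_cball)
  ultimately show ?thesis
    using compact_Int_closed[OF _ closed_closure, of ?C "translates f"] by (simp add: Int_absorb1)
qed

section \<open>Measurability and continuity of the pairing\<close>

lemma tendsto_by_approximation:
  fixes x :: "nat \<Rightarrow> complex"
  assumes "\<And>e. e > 0 \<Longrightarrow> \<exists>y m. y \<longlonglongrightarrow> m \<and> (\<forall>k. cmod (x k - y k) \<le> e) \<and> cmod (l - m) \<le> e"
  shows "x \<longlonglongrightarrow> l"
proof (rule tendstoI)
  fix e :: real assume "e > 0"
  then obtain y m where y: "y \<longlonglongrightarrow> m" "\<And>k. cmod (x k - y k) \<le> e/4" "cmod (l - m) \<le> e/4"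
    using assms[of "e/4"] by auto
  have "\<forall>\<^sub>F k in sequentially. dist (y k) m < e/4" using y(1) \<open>e > 0\<close> by (intro tendstoD) auto
  then show "\<forall>\<^sub>F k in sequentially. dist (x k) l < e"
  proof eventually_elim
    case (elim k)
    have "dist (x k) l \<le> dist (x k) (y k) + dist (y k) m + dist l m"
      by metric
    then show ?case using elim y(2)[of k] y(3) \<open>e > 0\<close> by (simp add: dist_norm)
  qed
qed

lemma borel_measurable_lebesgue_AE_LIMSEQ:
  fixes u :: "nat \<Rightarrow> real \<Rightarrow> 'b::euclidean_space"
  assumes "\<And>n. u n \<in> borel_measurable lebesgue" "AE r in lebesgue. (\<lambda>n. u n r) \<longlonglongrightarrow> v r"
  shows "v \<in> borel_measurable lebesgue"
proof (rule borel_measurable_AE[OF borel_measurable_lim_metric[OF assms(1)]])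
  show "AE r in lebesgue. lim (\<lambda>n. u n r) = v r"
    using assms(2) by eventually_elim (rule limI)
qed

text \<open>On each of the finitely many level sets of \<open>s\<close> the second argument of
  \<open>F\<close> is constant.\<close>

lemma borel_measurable_simple_argument:
  fixes F :: "real \<Rightarrow> 'd \<Rightarrow> 'b::euclidean_space"
  assumes "finite (range s)" "\<And>y. s -` {y} \<in> sets lebesgue"
    and "\<And>y. y \<in> range s \<Longrightarrow> (\<lambda>r. F r y) \<in> borel_measurable lebesgue"
  shows "(\<lambda>r. F r (s r)) \<in> borel_measurable lebesgue"
proof -
  have "(\<lambda>r. \<Sum>y\<in>range s. indicator (s -` {y}) r *\<^sub>R F r y) \<in> borel_measurable lebesgue"
    using assms by (intro borel_measurable_sum borel_measurable_scaleR borel_measurable_indicator) auto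
  moreover have "(\<Sum>y\<in>range s. indicator (s -` {y}) r *\<^sub>R F r y) = F r (s r)" for r
  proof -
    have "(\<Sum>y\<in>range s. indicator (s -` {y}) r *\<^sub>R F r y) = (\<Sum>y\<in>range s. if y = s r then F r y else 0)"
      by (intro sum.cong) (auto simp: indicator_def)
    then show ?thesis using assms(1) by simp
  qed
  ultimately show ?thesis by simp
qed

lemma continuous_imp_measurable_lebesgue:
  fixes u :: "real \<Rightarrow> 'b::euclidean_space"
  assumes "continuous_on UNIV u"
  shows "u \<in> borel_measurable lebesgue"
  using borel_measurable_continuous_onI[OF assms] by (intro measurable_completion) simp

lemma BUC_slice_uniformly_continuous:
  assumes f: "f \<in> BUC J" and \<phi>: "\<phi> \<in> cdual J"
  shows "uniformly_continuous_on UNIV (\<lambda>r. f r \<phi>)"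
  unfolding uniformly_continuous_on_def
proof (intro allI impI)
  fix e :: real assume e: "e > 0"
  \<comment> \<open>Adding 1 avoids dividing by zero when \<open>\<phi>\<close> is the zero
    functional.\<close>
  have pos: "0 < dnorm \<phi> + 1" using dnorm_nonneg[OF \<phi>] by simp
  obtain d where d: "d > 0"
    "\<And>r s \<psi>. \<bar>r - s\<bar> < d \<Longrightarrow> \<psi> \<in> cdual J \<Longrightarrow> cmod (f r \<psi> - f s \<psi>) \<le> e / (dnorm \<phi> + 1) * dnorm \<psi>"
    using BUC_modulus[OF f, of "e / (dnorm \<phi> + 1)"] e pos by (metis divide_pos_pos)
  have "e / (dnorm \<phi> + 1) * dnorm \<phi> < e" using e pos by (simp add: field_simps)
  then show "\<exists>d>0. \<forall>x\<in>UNIV. \<forall>x'\<in>UNIV. dist x' x < d \<longrightarrow> dist (f x' \<phi>) (f x \<phi>) < e"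
    using d(1) d(2)[OF _ \<phi>] by (intro exI[of _ d]) (auto simp: dist_norm intro: le_less_trans)
qed

lemma bidual_tendsto_of_dnorm:
  assumes \<xi>: "\<xi> \<in> bidual J" and s: "\<And>n. s n \<in> cdual J" and \<psi>: "\<psi> \<in> cdual J"
    and lim: "(\<lambda>n. dnorm (\<lambda>x. s n x - \<psi> x)) \<longlonglongrightarrow> 0"
  shows "(\<lambda>n. \<xi> (s n)) \<longlonglongrightarrow> \<xi> \<psi>"
proof -
  have "(\<lambda>n. \<xi> (s n) - \<xi> \<psi>) \<longlonglongrightarrow> 0"
  proof (rule Lim_null_comparison)
    show "\<forall>\<^sub>F n in sequentially. cmod (\<xi> (s n) - \<xi> \<psi>) \<le> bnorm J \<xi> * dnorm (\<lambda>x. s n x - \<psi> x)"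
      using bnorm_bound[OF \<xi> cdual_diff[OF s \<psi>]] bidual_minus[OF \<xi> s \<psi>] by simp
    show "(\<lambda>n. bnorm J \<xi> * dnorm (\<lambda>x. s n x - \<psi> x)) \<longlonglongrightarrow> 0"
      using tendsto_mult_right_zero[OF lim] by simp
  qed
  then show ?thesis by (simp add: LIM_zero_iff)
qed

text \<open>For a fixed functional the slice of \<open>h\<close> is continuous, which settles simple
  functions in place of \<open>g\<close>; the general case is an almost everywhere limit, as each
  \<open>h r\<close> is norm continuous on the dual.\<close>

lemma L1_pairing_measurable:
  assumes h: "h \<in> BUC J" and g: "g \<in> L1 J"
  shows "(\<lambda>r. h r (g r)) \<in> borel_measurable lebesgue"
proof -
  obtain s where s: "\<And>n. finite (range (s n))" "\<And>n. range (s n) \<subseteq> cdual J" "\<And>n y. s n -` {y} \<in> sets lebesgue"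
    and lim: "AE r in lebesgue. (\<lambda>n. dnorm (\<lambda>x. s n r x - g r x)) \<longlonglongrightarrow> 0"
    using g unfolding L1_def strongly_measurable_def by blast
  have hb: "\<And>r. h r \<in> bidual J" using h by (simp add: BUC_def)
  have gd: "\<And>r. g r \<in> cdual J" using g by (simp add: L1_def)
  show ?thesis
  proof (rule borel_measurable_lebesgue_AE_LIMSEQ)
    show "(\<lambda>r. h r (s n r)) \<in> borel_measurable lebesgue" for n
    proof (rule borel_measurable_simple_argument[OF s(1,3)])
      fix y assume "y \<in> range (s n)"
      then have "y \<in> cdual J" using s(2) by blast
      then show "(\<lambda>r. h r y) \<in> borel_measurable lebesgue"
        by (intro continuous_imp_measurable_lebesgue uniformly_continuous_imp_continuous
            BUC_slice_uniformly_continuous[OF h])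
    qed
    show "AE r in lebesgue. (\<lambda>n. h r (s n r)) \<longlonglongrightarrow> h r (g r)"
      using lim by eventually_elim (intro bidual_tendsto_of_dnorm[OF hb] gd, use s(2) in auto)
  qed
qed

text \<open>Finiteness of the nonnegative integral gives no measurability; that comes from the
  approximating simple functions.\<close>

lemma L1_dnorm_integrable:
  assumes g: "g \<in> L1 J"
  shows "integrable lebesgue (\<lambda>r. dnorm (g r))"
proof (rule integrableI_nonneg)
  obtain s where s: "\<And>n. finite (range (s n))" "\<And>n. range (s n) \<subseteq> cdual J" "\<And>n y. s n -` {y} \<in> sets lebesgue"
    and lim: "AE r in lebesgue. (\<lambda>n. dnorm (\<lambda>x. s n r x - g r x)) \<longlonglongrightarrow> 0"
    using g unfolding L1_def strongly_measurable_def by blast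
  have gd: "\<And>r. g r \<in> cdual J" using g by (simp add: L1_def)
  show "(\<lambda>r. dnorm (g r)) \<in> borel_measurable lebesgue"
  proof (rule borel_measurable_lebesgue_AE_LIMSEQ)
    show "(\<lambda>r. dnorm (s n r)) \<in> borel_measurable lebesgue" for n
      by (rule borel_measurable_simple_argument[OF s(1,3)]) simp
    show "AE r in lebesgue. (\<lambda>n. dnorm (s n r)) \<longlonglongrightarrow> dnorm (g r)"
      using lim
    proof eventually_elim
      case (elim r)
      have sr: "s n r \<in> cdual J" for n using s(2) by blast
      have "(\<lambda>n. dnorm (s n r) - dnorm (g r)) \<longlonglongrightarrow> 0"
        by (rule Lim_null_comparison[OF _ elim]) (simp add: dnorm_triangle_diff[OF sr gd])
      then show ?case by (simp add: LIM_zero_iff)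
    qed
  qed
  show "AE r in lebesgue. 0 \<le> dnorm (g r)" using dnorm_nonneg[OF gd] by simp
  show "(\<integral>\<^sup>+ r. ennreal (dnorm (g r)) \<partial>lebesgue) < \<infinity>" using g by (simp add: L1_def)
qed

text \<open>Only countably many evaluations matter for a fixed g in L1: rational times, and the values
  of the approximating simple functions. Hence dominated convergence, a statement about sequences,
  yields continuity.\<close>

lemma pairing_continuous_on_hull:
  assumes f: "f \<in> BUC J" and g: "g \<in> L1 J"
  shows "continuous_on (closure (translates f)) (pairing g)"
proof -
  obtain s where s: "\<And>n. finite (range (s n))" "\<And>n. range (s n) \<subseteq> cdual J"
    and lim: "AE r in lebesgue. (\<lambda>n. dnorm (\<lambda>x. s n r x - g r x)) \<longlonglongrightarrow> 0"
    using g unfolding L1_def strongly_measurable_def by blast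
  have gd: "\<And>r. g r \<in> cdual J" using g by (simp add: L1_def)
  obtain B where B: "\<And>r \<phi>. \<phi> \<in> cdual J \<Longrightarrow> cmod (f r \<phi>) \<le> B * dnorm \<phi>"
    using BUC_bound[OF f] by metis
  define D where "D = (\<Union>n. range (s n))"
  have D: "D \<subseteq> cdual J" using s(2) by (auto simp: D_def)
  have "countable ((\<rat>::real set) \<times> D)"
    using s(1) by (intro countable_SIGMA countable_rat) (auto simp: D_def intro: countable_finite)
  moreover have "(\<rat>::real set) \<times> D \<noteq> {}" unfolding D_def using Rats_0 by blast
  ultimately have "range (from_nat_into (\<rat> \<times> D)) = (\<rat>::real set) \<times> D"
    by (intro range_from_nat_into)
  then obtain c :: "nat \<Rightarrow> real \<times> 'a dualv" where c: "range c = \<rat> \<times> D" ..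
  show ?thesis
  proof (rule continuous_on_countably_many_coordinates[where e = "\<lambda>n h. h (fst (c n)) (snd (c n))"])
    show "continuous_on (closure (translates f)) (\<lambda>h. h (fst (c n)) (snd (c n)))" for n
      by (rule continuous_on_eval)
  next
    fix x :: "nat \<Rightarrow> real \<Rightarrow> 'a bidualv" and l
    assume x: "\<And>k. x k \<in> closure (translates f)" and l: "l \<in> closure (translates f)"
      and e: "\<And>n. (\<lambda>k. x k (fst (c n)) (snd (c n))) \<longlonglongrightarrow> l (fst (c n)) (snd (c n))"
    have rat: "(\<lambda>k. x k q \<phi>) \<longlonglongrightarrow> l q \<phi>" if "q \<in> \<rat>" "\<phi> \<in> D" for q \<phi>
    proof -
      have "(q, \<phi>) \<in> range c" using that by (simp add: c)
      then obtain n where "(q, \<phi>) = c n" by (rule rangeE)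
      then have "q = fst (c n)" "\<phi> = snd (c n)" by (metis fst_conv, metis snd_conv)
      then show ?thesis using e[of n] by (simp only:)
    qed
    \<comment> \<open>The orbit closure shares the modulus of continuity of \<open>f\<close>, so
      convergence at a nearby rational time transfers to \<open>r\<close> with an error uniform in
      \<open>k\<close>.\<close>
    have real: "(\<lambda>k. x k r \<phi>) \<longlonglongrightarrow> l r \<phi>" if \<phi>: "\<phi> \<in> D" for r \<phi>
    proof (rule tendsto_by_approximation)
      fix e :: real assume e: "e > 0"
      have pos: "0 < dnorm \<phi> + 1" using dnorm_nonneg[of \<phi> J] D \<phi> by auto
      obtain d where d: "d > 0"
        "\<And>r s \<psi>. \<bar>r - s\<bar> < d \<Longrightarrow> \<psi> \<in> cdual J \<Longrightarrow> cmod (f r \<psi> - f s \<psi>) \<le> e / (dnorm \<phi> + 1) * dnorm \<psi>"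
        using BUC_modulus[OF f, of "e / (dnorm \<phi> + 1)"] e pos by (metis divide_pos_pos)
      have le: "e / (dnorm \<phi> + 1) * dnorm \<phi> \<le> e" using e pos by (simp add: field_simps)
      obtain q where q: "q \<in> \<rat>" "\<bar>r - q\<bar> < d"
        using Rats_closure_real d(1) by (metis UNIV_I closure_approachable dist_commute dist_real_def)
      have "cmod (h r \<phi> - h q \<phi>) \<le> e" if "h \<in> closure (translates f)" for h
        using closure_translates_modulus[OF that d(2) subsetD[OF D \<phi>] q(2)] le by simp
      with rat[OF q(1) \<phi>] x l
      show "\<exists>y m. y \<longlonglongrightarrow> m \<and> (\<forall>k. cmod (x k r \<phi> - y k) \<le> e) \<and> cmod (l r \<phi> - m) \<le> e"
        by blast
    qed
    show "(\<lambda>k. pairing g (x k)) \<longlonglongrightarrow> pairing g l"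
      unfolding pairing_def
    proof (rule integral_dominated_convergence[where w = "\<lambda>r. B * dnorm (g r)"])
      show "(\<lambda>r. l r (g r)) \<in> borel_measurable lebesgue"
        by (intro L1_pairing_measurable[OF _ g] closure_translates_BUC[OF f l])
      show "(\<lambda>r. x k r (g r)) \<in> borel_measurable lebesgue" for k
        by (intro L1_pairing_measurable[OF _ g] closure_translates_BUC[OF f x])
      show "integrable lebesgue (\<lambda>r. B * dnorm (g r))"
        using L1_dnorm_integrable[OF g] by simp
      show "AE r in lebesgue. cmod (x k r (g r)) \<le> B * dnorm (g r)" for k
        using closure_translates_bound[OF x B gd] by simp
      show "AE r in lebesgue. (\<lambda>k. x k r (g r)) \<longlonglongrightarrow> l r (g r)"
        using lim
      proof eventually_elim
        case (elim r)
        show ?case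
        proof (rule tendsto_by_approximation)
          fix e :: real assume e: "e > 0"
          \<comment> \<open>The common bound \<open>B\<close> makes replacing \<open>g r\<close> by
            a simple value \<open>s n r\<close> cost less than \<open>e\<close>, uniformly in
            \<open>k\<close>.\<close>
          have "(\<lambda>n. B * dnorm (\<lambda>y. s n r y - g r y)) \<longlonglongrightarrow> 0"
            using tendsto_mult_right_zero[OF elim] by simp
          then have "\<forall>\<^sub>F n in sequentially. B * dnorm (\<lambda>y. s n r y - g r y) < e"
            using e by (rule order_tendstoD)
          then obtain n where n: "B * dnorm (\<lambda>y. s n r y - g r y) < e"
            by (auto simp: eventually_sequentially)
          have sn: "s n r \<in> D" "s n r \<in> cdual J" using D by (auto simp: D_def)
          have "cmod (h r (g r) - h r (s n r)) \<le> e" if h: "h \<in> closure (translates f)" for h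
            using closure_translates_bound[OF h B cdual_diff[OF sn(2) gd[of r]], of r] n
              bidual_minus[OF closure_translates_bidual[OF f h] sn(2) gd[of r], of r]
            by (simp add: norm_minus_commute)
          with real[OF sn(1)] x l
          show "\<exists>y m. y \<longlonglongrightarrow> m \<and> (\<forall>k. cmod (x k r (g r) - y k) \<le> e) \<and> cmod (l r (g r) - m) \<le> e"
            by blast
        qed
      qed
    qed
  qed
qed

section \<open>The semigroup of limits of translations\<close>

text \<open>Test functions: pairing with them integrates a slice over an interval, which is enough
  to separate points.\<close>

lemma L1_interval:
  assumes \<phi>: "\<phi> \<in> cdual J"
  shows "(\<lambda>u. if u \<in> {a..b} then \<phi> else (\<lambda>x. 0)) \<in> L1 J"
proof -
  let ?g = "\<lambda>u. if u \<in> {a..b} then \<phi> else (\<lambda>x. 0)"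
  have "range ?g \<subseteq> {\<phi>, \<lambda>x. 0}" by auto
  then have "finite (range ?g)" "range ?g \<subseteq> cdual J"
    using \<phi> cdual_zero[of J] finite_subset by auto
  moreover have "?g -` {y} \<in> sets lebesgue" for y
  proof -
    have "?g -` {y} = (if \<phi> = y then {a..b} else {}) \<union> (if (\<lambda>x. 0) = y then - {a..b} else {})"
      by (auto split: if_splits)
    then show ?thesis by (simp add: Compl_in_sets_lebesgue)
  qed
  moreover have "AE r in lebesgue. (\<lambda>n::nat. dnorm (\<lambda>x. ?g r x - ?g r x)) \<longlonglongrightarrow> 0"
    by (simp add: dnorm_def onorm_zero)
  ultimately have "strongly_measurable J ?g"
    unfolding strongly_measurable_def by (intro exI[of _ "\<lambda>n. ?g"]) blast
  moreover have "(\<integral>\<^sup>+ r. ennreal (dnorm (?g r)) \<partial>lebesgue) < \<infinity>"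
  proof -
    have "(\<integral>\<^sup>+ r. ennreal (dnorm (?g r)) \<partial>lebesgue)
        = (\<integral>\<^sup>+ r. ennreal (dnorm \<phi>) * indicator {a..b} r \<partial>lebesgue)"
      by (intro nn_integral_cong) (auto simp: dnorm_def onorm_zero)
    also have "\<dots> = ennreal (dnorm \<phi>) * emeasure lebesgue {a..b}"
      by (intro nn_integral_cmult_indicator) auto
    also have "\<dots> < \<infinity>"
      by (simp add: ennreal_mult_less_top emeasure_lborel_Icc_eq)
    finally show ?thesis .
  qed
  ultimately show ?thesis using \<phi> cdual_zero[of J] by (auto simp: L1_def)
qed

lemma pairing_interval:
  assumes h: "h \<in> BUC J" and \<phi>: "\<phi> \<in> cdual J"
  shows "pairing (\<lambda>u. if u \<in> {a..b} then \<phi> else (\<lambda>x. 0)) h = integral {a..b} (\<lambda>u. h u \<phi>)"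
proof -
  have hb: "\<And>r. h r \<in> bidual J" using h by (simp add: BUC_def)
  have "continuous_on {a..b} (\<lambda>u. h u \<phi>)"
    using uniformly_continuous_imp_continuous[OF BUC_slice_uniformly_continuous[OF h \<phi>]]
    by (rule continuous_on_subset) simp
  then have "(LINT u:{a..b}|lebesgue. h u \<phi>) = integral {a..b} (\<lambda>u. h u \<phi>)"
    by (intro set_lebesgue_integral_eq_integral(2) absolutely_integrable_continuous_real)
  moreover have "h u (if u \<in> {a..b} then \<phi> else (\<lambda>x. 0)) = indicator {a..b} u *\<^sub>R h u \<phi>" for u
    using bidual_zero[OF hb] by (auto simp: indicator_def)
  ultimately show ?thesis by (simp add: pairing_def set_lebesgue_integral_def)
qed

text \<open>Near a time \<open>r\<close> where two slices differ, their difference \<open>D\<close>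
  stays within half of \<open>cmod (D r)\<close> of \<open>D r\<close>, so its integral over a short
  interval cannot vanish.\<close>

lemma pairing_separates:
  assumes h: "h \<in> BUC J" "k \<in> BUC J" "h \<noteq> k"
  obtains g where "g \<in> L1 J" "pairing g h \<noteq> pairing g k"
proof -
  obtain r \<phi> where r: "h r \<phi> \<noteq> k r \<phi>" using h(3) by (meson ext)
  have hb: "\<And>r. h r \<in> bidual J" "\<And>r. k r \<in> bidual J" using h by (simp_all add: BUC_def)
  have \<phi>: "\<phi> \<in> cdual J" using r bidual_outside[OF hb(1)] bidual_outside[OF hb(2)] by metis
  define D where "D u = h u \<phi> - k u \<phi>" for u
  have cont: "continuous_on S (\<lambda>u. h u \<phi>)" "continuous_on S (\<lambda>u. k u \<phi>)" for S
    using uniformly_continuous_imp_continuous[OF BUC_slice_uniformly_continuous[OF h(1) \<phi>]]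
      uniformly_continuous_imp_continuous[OF BUC_slice_uniformly_continuous[OF h(2) \<phi>]]
    by (auto intro: continuous_on_subset)
  have contD: "continuous_on S D" for S
    unfolding D_def by (intro continuous_on_diff cont)
  have Dr: "0 < cmod (D r)" using r by (simp add: D_def)
  obtain d where d: "d > 0" "\<And>u. dist u r < d \<Longrightarrow> dist (D u) (D r) < cmod (D r) / 2"
    using contD[of UNIV] Dr unfolding continuous_on_iff by (metis UNIV_I half_gt_zero)
  \<comment> \<open>Half of \<open>d\<close> keeps the closed interval inside the open
    neighbourhood.\<close>
  define b where "b = r + d/2"
  have b: "r < b" using d(1) by (simp add: b_def)
  have "norm (integral {r..b} (\<lambda>u. D u - D r)) \<le> cmod (D r) / 2 * (b - r)"
  proof (rule integral_bound)
    show "continuous_on {r..b} (\<lambda>u. D u - D r)" by (intro continuous_on_diff contD continuous_on_const)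
    show "norm (D u - D r) \<le> cmod (D r) / 2" if "u \<in> {r..b}" for u
      using d(2)[of u] that d(1) by (simp add: b_def dist_norm)
  qed (use b in simp)
  also have "integral {r..b} (\<lambda>u. D u - D r) = integral {r..b} D - (b - r) *\<^sub>R D r"
    using b by (subst integral_diff) (auto intro: integrable_continuous_real contD)
  finally have *: "cmod (integral {r..b} D - (b - r) *\<^sub>R D r) \<le> cmod (D r) / 2 * (b - r)" .
  have "integral {r..b} D \<noteq> 0"
  proof
    assume "integral {r..b} D = 0"
    with * b have "(b - r) * cmod (D r) \<le> (b - r) * (cmod (D r) / 2)"
      by (simp add: mult.commute)
    with b Dr show False by (simp only: mult_le_cancel_left_pos)
  qed
  moreover have "integral {r..b} D = integral {r..b} (\<lambda>u. h u \<phi>) - integral {r..b} (\<lambda>u. k u \<phi>)"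
    unfolding D_def by (intro integral_diff integrable_continuous_real cont)
  ultimately have "integral {r..b} (\<lambda>u. h u \<phi>) \<noteq> integral {r..b} (\<lambda>u. k u \<phi>)" by simp
  then show ?thesis
    using that[OF L1_interval[OF \<phi>]] pairing_interval[OF h(1) \<phi>] pairing_interval[OF h(2) \<phi>] by metis
qed

lemma topspace_wstar_WW: "topspace (wstar_WW J) = WW J"
proof -
  obtain g where "g \<in> L1 J" using L1_interval[OF cdual_zero] by blast
  then have "{f \<in> WW J. pairing g f \<in> UNIV} \<in> {{f \<in> WW J. pairing g f \<in> U} | g U. g \<in> L1 J \<and> open U}"
    using open_UNIV by blast
  then show ?thesis unfolding wstar_WW_def topology_generated_by_topspace by auto
qed

lemma openin_wstar_WW: "g \<in> L1 J \<Longrightarrow> open U \<Longrightarrow> openin (wstar_WW J) {f \<in> WW J. pairing g f \<in> U}"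
  unfolding wstar_WW_def by (rule topology_generated_by_Basis) blast

lemma Hausdorff_wstar_WW: "Hausdorff_space (wstar_WW J)"
  unfolding Hausdorff_space_def topspace_wstar_WW
proof (intro allI impI, elim conjE)
  fix h k assume hk: "h \<in> WW J" "k \<in> WW J" "h \<noteq> k"
  then obtain g where g: "g \<in> L1 J" "pairing g h \<noteq> pairing g k"
    using pairing_separates[of h J k] by (auto simp: WW_def)
  obtain U V where UV: "open U" "open V" "pairing g h \<in> U" "pairing g k \<in> V" "U \<inter> V = {}"
    using hausdorff[OF g(2)] by blast
  show "\<exists>U V. openin (wstar_WW J) U \<and> openin (wstar_WW J) V \<and> h \<in> U \<and> k \<in> V \<and> disjnt U V"
    using openin_wstar_WW[OF g(1) UV(1)] openin_wstar_WW[OF g(1) UV(2)] hk UV(3-5)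
    by (intro exI[of _ "{f \<in> WW J. pairing g f \<in> U}"] exI[of _ "{f \<in> WW J. pairing g f \<in> V}"])
      (auto simp: disjnt_def)
qed

text \<open>The identity from the pointwise to the \<open>wstar_WW\<close> topology is continuous
  because all pairings are; from a compact space onto a Hausdorff space it is then a
  homeomorphism.\<close>

lemma subtopology_wstar_hull:
  assumes f: "f \<in> WW J"
  shows "subtopology (wstar_WW J) (closure (translates f)) = top_of_set (closure (translates f))"
proof -
  let ?H = "closure (translates f)"
  have H: "?H \<subseteq> WW J" using closure_translates_WW[OF f] by blast
  have fB: "f \<in> BUC J" using f by (simp add: WW_def)
  have "continuous_map (top_of_set ?H) (wstar_WW J) id"
    unfolding wstar_WW_def
  proof (rule continuous_on_generated_topo)
    fix A assume "A \<in> {{f \<in> WW J. pairing g f \<in> U} |g U. g \<in> L1 J \<and> open U}"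
    then obtain g U where gU: "A = {f \<in> WW J. pairing g f \<in> U}" "g \<in> L1 J" "open U" by blast
    have "openin (top_of_set ?H) (?H \<inter> pairing g -` U)"
      using pairing_continuous_on_hull[OF fB gU(2)] gU(3) by (rule continuous_openin_preimage_gen)
    moreover have "id -` A \<inter> topspace (top_of_set ?H) = ?H \<inter> pairing g -` U" using H gU(1) by auto
    ultimately show "openin (top_of_set ?H) (id -` A \<inter> topspace (top_of_set ?H))" by simp
  next
    show "id ` topspace (top_of_set ?H) \<subseteq> \<Union> {{f \<in> WW J. pairing g f \<in> U} |g U. g \<in> L1 J \<and> open U}"
      using H topspace_wstar_WW[of J] unfolding wstar_WW_def topology_generated_by_topspace by simp
  qed
  then have "continuous_map (top_of_set ?H) (subtopology (wstar_WW J) ?H) id"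
    by (simp add: continuous_map_in_subtopology)
  moreover have "compact_space (top_of_set ?H)"
    using compact_closure_translates[OF fB] by (simp add: compact_space_subtopology)
  moreover have "Hausdorff_space (subtopology (wstar_WW J) ?H)"
    by (intro Hausdorff_space_subtopology Hausdorff_wstar_WW)
  moreover have "id ` topspace (top_of_set ?H) = topspace (subtopology (wstar_WW J) ?H)"
    using H by (auto simp: topspace_wstar_WW)
  ultimately have "homeomorphic_map (top_of_set ?H) (subtopology (wstar_WW J) ?H) id"
    by (intro continuous_imp_homeomorphic_map) auto
  then show ?thesis by simp
qed

text \<open>A compact subspace of \<open>op_top\<close> containing \<open>Tcal\<close>, each coordinate of which carries the pointwise
  topology by \<open>subtopology_wstar_hull\<close>.\<close>

definition hull_top :: "('a::banach \<Rightarrow> 'a) \<Rightarrow> ((real \<Rightarrow> 'a bidualv) \<Rightarrow> (real \<Rightarrow> 'a bidualv)) topology" where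
  "hull_top J = product_topology (\<lambda>f. subtopology (wstar_WW J) (closure (translates f))) (WW J)"

abbreviation transl_op :: "('a::banach \<Rightarrow> 'a) \<Rightarrow> real \<Rightarrow> (real \<Rightarrow> 'a bidualv) \<Rightarrow> (real \<Rightarrow> 'a bidualv)" where
  "transl_op J t \<equiv> restrict (transl t) (WW J)"

lemma topspace_hull_top: "topspace (hull_top J) = (\<Pi>\<^sub>E f\<in>WW J. closure (translates f))"
proof -
  have "topspace (subtopology (wstar_WW J) (closure (translates f))) = closure (translates f)" if "f \<in> WW J" for f
    by (simp add: subtopology_wstar_hull[OF that])
  then show ?thesis unfolding hull_top_def topspace_product_topology by (intro PiE_cong)
qed

lemma hull_top_map_WW: "U \<in> topspace (hull_top J) \<Longrightarrow> f \<in> WW J \<Longrightarrow> U f \<in> WW J"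
  using closure_translates_WW by (auto simp: topspace_hull_top PiE_iff)

lemma compact_hull_top: "compact_space (hull_top J)"
proof -
  have "compact_space (subtopology (wstar_WW J) (closure (translates f)))" if "f \<in> WW J" for f
    using compact_closure_translates[of f J] that
    by (simp add: subtopology_wstar_hull[OF that] compact_space_subtopology WW_def)
  then show ?thesis unfolding hull_top_def compact_space_product_topology by blast
qed

lemma Hausdorff_hull_top: "Hausdorff_space (hull_top J)"
  unfolding hull_top_def Hausdorff_space_product_topology
  by (simp add: Hausdorff_space_subtopology Hausdorff_wstar_WW)

lemma continuous_map_hull_coordinate:
  assumes "f \<in> WW J"
  shows "continuous_map (hull_top J) (top_of_set (closure (translates f))) (\<lambda>U. U f)"
  using continuous_map_product_projection[OF assms, of "\<lambda>f. subtopology (wstar_WW J) (closure (translates f))"]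
  by (simp add: hull_top_def subtopology_wstar_hull[OF assms])

lemma continuous_map_into_hull_top:
  assumes "F ` topspace X \<subseteq> extensional (WW J)"
    and "\<And>f. f \<in> WW J \<Longrightarrow> continuous_map X (top_of_set (closure (translates f))) (\<lambda>x. F x f)"
  shows "continuous_map X (hull_top J) F"
  using assms unfolding hull_top_def continuous_map_componentwise
  by (simp add: subtopology_wstar_hull)

lemma closure_translates_mono:
  assumes "h \<in> closure (translates f)"
  shows "closure (translates h) \<subseteq> closure (translates f)"
  using closure_translates_shift[OF assms] by (intro closure_minimal closed_closure) auto

text \<open>The value of \<open>U V\<close> at \<open>f\<close> is the value of \<open>U\<close> at
  the fixed point \<open>V f\<close> of \<open>WW J\<close>, that is, a coordinate projection of
  \<open>hull_top\<close>.\<close>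

lemma continuous_compose_right:
  assumes V: "V \<in> topspace (hull_top J)"
  shows "continuous_map (hull_top J) (hull_top J) (\<lambda>U. compose (WW J) U V)"
proof (rule continuous_map_into_hull_top)
  fix f assume f: "f \<in> WW J"
  have Vf: "V f \<in> WW J" "V f \<in> closure (translates f)"
    using hull_top_map_WW[OF V f] V f by (auto simp: topspace_hull_top PiE_iff)
  have "continuous_map (hull_top J) (top_of_set (closure (translates f))) (\<lambda>U. U (V f))"
    using continuous_map_hull_coordinate[OF Vf(1)] closure_translates_mono[OF Vf(2)]
    by (auto simp: continuous_map_in_subtopology)
  then show "continuous_map (hull_top J) (top_of_set (closure (translates f))) (\<lambda>U. compose (WW J) U V f)"
    using f by (simp add: compose_def)
qed (auto simp: compose_def)

text \<open>Here the varying operator acts first, so the fixed one must itself be pointwise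
  continuous on each orbit closure; a translation is.\<close>

lemma continuous_compose_transl_left:
  "continuous_map (hull_top J) (hull_top J) (\<lambda>U. compose (WW J) (transl_op J t) U)"
proof (rule continuous_map_into_hull_top)
  fix f assume f: "f \<in> WW J"
  let ?H = "closure (translates f)"
  have "continuous_on ?H (transl t)"
    unfolding transl_def
    by (rule continuous_on_coordinatewise_then_product,
        rule continuous_on_product_then_coordinatewise[OF continuous_on_id])
  moreover have "transl t ` ?H \<subseteq> ?H"
    using closure_translates_shift by (auto simp: transl_def)
  ultimately have "continuous_map (top_of_set ?H) (top_of_set ?H) (transl t)"
    by (auto simp: continuous_map_in_subtopology)
  then have "continuous_map (hull_top J) (top_of_set ?H) (transl t \<circ> (\<lambda>U. U f))"
    by (rule continuous_map_compose[OF continuous_map_hull_coordinate[OF f]])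
  moreover have "(transl t \<circ> (\<lambda>U. U f)) U = compose (WW J) (transl_op J t) U f" if "U \<in> topspace (hull_top J)" for U
    using hull_top_map_WW[OF that f] f by (simp add: compose_def)
  ultimately show "continuous_map (hull_top J) (top_of_set ?H) (\<lambda>U. compose (WW J) (transl_op J t) U f)"
    by (rule continuous_map_eq)
qed (auto simp: compose_def)

section \<open>\<open>Tcal\<close> as a compact semigroup\<close>

lemma transl_op_hull: "transl_op J t \<in> topspace (hull_top J)"
  using closure_subset by (fastforce simp: topspace_hull_top transl_def)

text \<open>Each orbit closure is compact in the Hausdorff space \<open>wstar_WW J\<close>, so their
  product is closed in \<open>op_top J\<close>; as it contains the translations, it contains their
  limits.\<close>

lemma Tcal_subset_hull: "Tcal J \<subseteq> topspace (hull_top J)"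
proof -
  have "closedin (op_top J) (\<Pi>\<^sub>E f\<in>WW J. closure (translates f))"
    unfolding op_top_def closedin_product_topology
  proof (intro disjI2 ballI compactin_imp_closedin Hausdorff_wstar_WW)
    fix f assume f: "f \<in> WW J"
    have "compact_space (subtopology (wstar_WW J) (closure (translates f)))"
      using compact_closure_translates[of f J] f
      by (simp add: subtopology_wstar_hull[OF f] compact_space_subtopology WW_def)
    moreover have "closure (translates f) \<subseteq> topspace (wstar_WW J)"
      using closure_translates_WW[OF f] by (auto simp: topspace_wstar_WW)
    ultimately show "compactin (wstar_WW J) (closure (translates f))"
      by (simp add: compactin_subspace)
  qed
  moreover have "{transl_op J t | t. True} \<subseteq> (\<Pi>\<^sub>E f\<in>WW J. closure (translates f))"
    using transl_op_hull[where J = J] unfolding topspace_hull_top by blast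
  ultimately show ?thesis
    unfolding Tcal_def topspace_hull_top by (intro closure_of_minimal)
qed

lemma hull_top_subtopology: "hull_top J = subtopology (op_top J) (topspace (hull_top J))"
proof -
  have "hull_top J = subtopology (op_top J) (\<Pi>\<^sub>E f\<in>WW J. closure (translates f))"
    unfolding op_top_def subtopology_product_topology hull_top_def ..
  then show ?thesis unfolding topspace_hull_top .
qed

lemma Tcal_top_hull: "Tcal_top J = subtopology (hull_top J) (Tcal J)"
  using Tcal_subset_hull[of J] unfolding Tcal_top_def
  by (subst hull_top_subtopology) (simp add: subtopology_subtopology Int_absorb1)

lemma Tcal_hull_closure: "Tcal J = hull_top J closure_of (range (transl_op J))"
proof -
  have "hull_top J closure_of (range (transl_op J))
      = topspace (hull_top J) \<inter> (op_top J closure_of (topspace (hull_top J) \<inter> range (transl_op J)))"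
    by (subst hull_top_subtopology) (rule closure_of_subtopology)
  also have "topspace (hull_top J) \<inter> range (transl_op J) = {transl_op J t | t. True}"
    using transl_op_hull[where J = J] by auto
  finally show ?thesis using Tcal_subset_hull[of J] unfolding Tcal_def by blast
qed

lemma compactin_Tcal: "compactin (hull_top J) (Tcal J)"
  unfolding Tcal_hull_closure by (intro closedin_compact_space compact_hull_top closedin_closure_of)

lemma transl_op_Tcal: "transl_op J t \<in> Tcal J"
  unfolding Tcal_hull_closure using transl_op_hull[where J = J]
  by (intro subsetD[OF closure_of_subset]) auto

text \<open>Two density arguments, in the order that one-sided continuity permits: first
  \<open>V\<close> is a limit with a translation in front of it, then \<open>U\<close> is a limit
  with \<open>V\<close> fixed.\<close>

lemma Tcal_compose:
  assumes U: "U \<in> Tcal J" and V: "V \<in> Tcal J"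
  shows "compose (WW J) U V \<in> Tcal J"
proof -
  have left: "compose (WW J) (transl_op J t) V \<in> Tcal J" for t
  proof -
    have "compose (WW J) (transl_op J t) (transl_op J u) = transl_op J (u + t)" for u
    proof
      fix f show "compose (WW J) (transl_op J t) (transl_op J u) f = transl_op J (u + t) f"
        using hull_top_map_WW[OF transl_op_hull, of f J u]
        by (auto simp: compose_def transl_def algebra_simps)
    qed
    then have "(\<lambda>U. compose (WW J) (transl_op J t) U) ` range (transl_op J) \<subseteq> range (transl_op J)"
      by auto
    then show ?thesis
      using continuous_map_image_closure_subset[OF continuous_compose_transl_left[of J t], of "range (transl_op J)"]
        closure_of_mono[of _ "range (transl_op J)" "hull_top J"] V
      unfolding Tcal_hull_closure by blast
  qed
  have "(\<lambda>U. compose (WW J) U V) ` Tcal J \<subseteq> hull_top J closure_of ((\<lambda>U. compose (WW J) U V) ` range (transl_op J))"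
    unfolding Tcal_hull_closure[of J]
    using continuous_map_image_closure_subset[OF continuous_compose_right] V Tcal_subset_hull
    unfolding Tcal_hull_closure by blast
  also have "\<dots> \<subseteq> hull_top J closure_of (Tcal J)"
    using left by (intro closure_of_mono) auto
  also have "\<dots> = Tcal J" unfolding Tcal_hull_closure by simp
  finally show ?thesis using U by blast
qed

text \<open>Composition is cut down to \<open>WW J\<close>, so associativity rests on the innermost
  operator mapping \<open>WW J\<close> into itself.\<close>

lemma Tcal_compose_assoc:
  assumes "W \<in> Tcal J"
  shows "compose (WW J) (compose (WW J) U V) W = compose (WW J) U (compose (WW J) V W)"
proof -
  have "W \<in> WW J \<rightarrow> WW J" using assms Tcal_subset_hull hull_top_map_WW by blast
  then show ?thesis by (simp add: compose_assoc)
qed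

section \<open>Minimal idempotents and scalar almost periodicity\<close>

text \<open>The left ideal generated by \<open>a = U P\<close> is a compact semigroup and contains
  an idempotent \<open>Q = V a\<close>. Multiplying by \<open>P\<close> on the left gives an
  idempotent that minimality identifies with \<open>P\<close>, so
  \<open>P = (P V) a\<close>.\<close>

lemma minimal_idempotent_reachable:
  assumes P: "minimal_idempotent J P" and U: "U \<in> Tcal J"
  obtains W where "W \<in> Tcal J" "compose (WW J) W (compose (WW J) U P) = P"
proof -
  let ?m = "compose (WW J)"
  have PT: "P \<in> Tcal J" and PP: "?m P P = P"
    and min: "\<And>Q. Q \<in> Tcal J \<Longrightarrow> ?m Q Q = Q \<Longrightarrow> ?m P Q = Q \<Longrightarrow> ?m Q P = P"
    using P unfolding minimal_idempotent_def by blast+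
  note assoc = Tcal_compose_assoc and closed = Tcal_compose
  define a where "a = ?m U P"
  have a: "a \<in> Tcal J" unfolding a_def by (rule closed[OF U PT])
  define L where "L = (\<lambda>V. ?m V a) ` Tcal J"
  have LT: "L \<subseteq> Tcal J" using closed[OF _ a] by (auto simp: L_def)
  have aH: "a \<in> topspace (hull_top J)" using a Tcal_subset_hull by blast
  obtain Q where Q: "Q \<in> L" "?m Q Q = Q"
  proof (rule Ellis_Numakura[OF Hausdorff_hull_top[of J], of L ?m])
    show "compactin (hull_top J) L"
      unfolding L_def by (rule image_compactin[OF compactin_Tcal continuous_compose_right[OF aH]])
    show "L \<noteq> {}" using PT by (auto simp: L_def)
  next
    fix x y assume xy: "x \<in> L" "y \<in> L"
    then obtain V where V: "V \<in> Tcal J" "y = ?m V a" by (auto simp: L_def)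
    have "?m x y = ?m (?m x V) a" unfolding V(2) by (rule assoc[OF a, symmetric])
    then show "?m x y \<in> L" using closed[of x J V] xy LT V(1) unfolding L_def by blast
  next
    fix x y z assume "z \<in> L"
    then show "?m (?m x y) z = ?m x (?m y z)" using LT by (intro assoc) blast
  next
    fix b assume "b \<in> L"
    then have "b \<in> topspace (hull_top J)" using LT Tcal_subset_hull by blast
    then show "continuous_map (subtopology (hull_top J) L) (hull_top J) (\<lambda>x. ?m x b)"
      by (intro continuous_map_from_subtopology continuous_compose_right)
  qed
  obtain V where V: "V \<in> Tcal J" "Q = ?m V a" using Q(1) by (auto simp: L_def)
  have QT: "Q \<in> Tcal J" using Q(1) LT by blast
  have aP: "?m a P = a" unfolding a_def assoc[OF PT] PP ..
  have QP: "?m Q P = Q" unfolding V(2) assoc[OF PT] aP ..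
  \<comment> \<open>Minimality of P speaks about idempotents R with P R = R, whereas Q only satisfies Q P = Q.\<close>
  define R where "R = ?m P Q"
  have RT: "R \<in> Tcal J" unfolding R_def by (rule closed[OF PT QT])
  have RP: "?m R P = R" unfolding R_def assoc[OF PT] QP ..
  have PR: "?m P R = R" unfolding R_def assoc[OF QT, symmetric] PP ..
  have "?m R R = ?m (?m R P) Q" unfolding R_def by (rule assoc[OF QT, symmetric])
  also have "\<dots> = ?m R Q" unfolding RP ..
  also have "\<dots> = R" unfolding R_def assoc[OF QT] Q(2) ..
  finally have "?m R P = P" using PR by (intro min RT)
  then have "R = P" using RP by simp
  then have "?m (?m P V) a = P" unfolding R_def V(2) assoc[OF a] .
  then show ?thesis using that[OF closed[OF PT V(1)]] by (simp add: a_def)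
qed

lemma Tcal_eval_continuous:
  assumes "f \<in> WW J"
  shows "continuous_map (hull_top J) euclidean (\<lambda>U. U f r \<phi>)"
proof -
  have "continuous_map (top_of_set (closure (translates f))) euclidean (\<lambda>h. h r \<phi>)"
    by (simp add: continuous_on_eval)
  from continuous_map_compose[OF continuous_map_hull_coordinate[OF assms] this]
  show ?thesis by (simp add: o_def)
qed

text \<open>Baire category, applied to the minimal left ideal M of all V P, gives a nonempty open set O on
  which U \<mapsto> (U f)(.) \<phi> varies by at most e in sup norm. By minimality every orbit meets O, so by
  compactness finitely many translates of O cover M.\<close>

lemma reversible_scalar_almost_periodic:
  assumes P: "minimal_idempotent J P" and f: "f \<in> WW J" "P f = f"
    and \<phi>: "\<phi> \<in> cdual J" and e: "e > 0"
  shows "finitely_coloured UNIV (\<lambda>t t'. \<forall>r. cmod (f (r + t) \<phi> - f (r + t') \<phi>) \<le> e)"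
proof -
  let ?m = "compose (WW J)"
  let ?T = "transl_op J"
  have PT: "P \<in> Tcal J" using P by (simp add: minimal_idempotent_def)
  then have PH: "P \<in> topspace (hull_top J)" using Tcal_subset_hull by blast
  define M where "M = (\<lambda>V. ?m V P) ` Tcal J"
  have MT: "M \<subseteq> Tcal J" using Tcal_compose[OF _ PT] by (auto simp: M_def)
  have MH: "M \<subseteq> topspace (hull_top J)" using MT Tcal_subset_hull by blast
  have Mcomp: "compactin (hull_top J) M"
    unfolding M_def by (rule image_compactin[OF compactin_Tcal continuous_compose_right[OF PH]])
  have Mleft: "?m V U \<in> M" if V: "V \<in> Tcal J" and U: "U \<in> M" for V U
  proof -
    obtain W where W: "W \<in> Tcal J" "U = ?m W P" using U by (auto simp: M_def)
    have "?m V U = ?m (?m V W) P" unfolding W(2) by (rule Tcal_compose_assoc[OF PT, symmetric])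
    then show ?thesis using Tcal_compose[OF V W(1)] unfolding M_def by blast
  qed
  define X where "X = subtopology (hull_top J) M"
  have topX: "topspace X = M" unfolding X_def using MH by auto
  have HX: "Hausdorff_space X" unfolding X_def by (intro Hausdorff_space_subtopology Hausdorff_hull_top)
  have CX: "compact_space X" unfolding X_def by (rule compact_space_subtopology[OF Mcomp])
  have fB: "f \<in> BUC J" and fW: "(\<lambda>r. f r \<phi>) \<in> Wfun" using f(1) \<phi> by (simp_all add: WW_def)
  obtain D :: "(real \<Rightarrow> complex) set" where D: "countable D"
    "\<And>h e. h \<in> closure (translates (\<lambda>r. f r \<phi>)) \<Longrightarrow> e > 0 \<Longrightarrow> \<exists>d\<in>D. \<forall>r. cmod (h r - d r) \<le> e"
    using Wfun_separable[OF fW BUC_slice_uniformly_continuous[OF fB \<phi>]] by blast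
  \<comment> \<open>Traces on \<open>M\<close> of sup-norm balls around a countable net. A bound at
    each single \<open>r\<close> is closed pointwise, and radius \<open>e/2\<close> makes two
    members differ by at most \<open>e\<close>.\<close>
  define A where "A d = {U \<in> M. \<forall>r. cmod (U f r \<phi> - d r) \<le> e/2}" for d
  have closedA: "closedin X (A d)" for d
  proof -
    have "closedin X {U \<in> topspace X. U f r \<phi> \<in> cball (d r) (e/2)}" for r
      unfolding X_def
      by (rule closedin_continuous_map_preimage[OF
            continuous_map_from_subtopology[OF Tcal_eval_continuous[OF f(1)]]]) simp
    then have "closedin X (\<Inter>r. {U \<in> topspace X. U f r \<phi> \<in> cball (d r) (e/2)})"
      by (intro closedin_INT) auto
    moreover have "(\<Inter>r. {U \<in> topspace X. U f r \<phi> \<in> cball (d r) (e/2)}) = A d"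
      by (auto simp: A_def topX dist_norm norm_minus_commute)
    ultimately show ?thesis by simp
  qed
  have cover: "\<Union> (A ` D) = M"
  proof
    show "M \<subseteq> \<Union> (A ` D)"
    proof
      fix U assume U: "U \<in> M"
      then have "U f \<in> closure (translates f)"
        using MH f(1) by (auto simp: topspace_hull_top PiE_iff)
      then have "(\<lambda>r. U f r \<phi>) \<in> closure (translates (\<lambda>r. f r \<phi>))"
        by (rule closure_translates_slice)
      then obtain d where "d \<in> D" "\<forall>r. cmod (U f r \<phi> - d r) \<le> e/2"
        using D(2)[of _ "e/2"] e by force
      with U show "U \<in> \<Union> (A ` D)" by (auto simp: A_def)
    qed
  qed (auto simp: A_def)
  have "M \<noteq> {}" using PT by (auto simp: M_def)
  obtain d where d: "X interior_of (A d) \<noteq> {}"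
  proof (rule ccontr)
    assume "\<not> thesis"
    with that have "\<And>d. X interior_of (A d) = {}" by blast
    then have "X interior_of \<Union> (A ` D) = {}"
      using closedA D(1) CX HX
      by (intro Baire_category_alt)
        (auto simp: compact_imp_locally_compact_space compact_Hausdorff_imp_regular_space)
    then show False using \<open>M \<noteq> {}\<close> unfolding cover topX[symmetric] by simp
  qed
  obtain O' where O': "openin (hull_top J) O'" "X interior_of (A d) = O' \<inter> M"
    using openin_interior_of[of X "A d"] unfolding X_def openin_subtopology by blast
  have small: "cmod (U f r \<phi> - d r) \<le> e/2" if "U \<in> O'" "U \<in> M" for U r
  proof -
    have "U \<in> X interior_of (A d)" unfolding O'(2) using that by blast
    then have "U \<in> A d" by (rule subsetD[OF interior_of_subset])
    then show ?thesis by (simp add: A_def)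
  qed
  define N where "N t = {U \<in> topspace (hull_top J). ?m (?T t) U \<in> O'}" for t
  have openN: "openin (hull_top J) (N t)" for t
    unfolding N_def by (rule openin_continuous_map_preimage[OF continuous_compose_transl_left O'(1)])
  have "\<exists>t. U \<in> N t" if U: "U \<in> M" for U
  proof -
    obtain V0 where V0: "V0 \<in> Tcal J" "?m V0 P \<in> O'"
      using d unfolding O'(2) M_def by blast
    obtain V where V: "V \<in> Tcal J" "U = ?m V P" using U by (auto simp: M_def)
    obtain W where W: "W \<in> Tcal J" "?m W U = P"
      using minimal_idempotent_reachable[OF P V(1)] V(2) by metis
    have UT: "U \<in> Tcal J" "U \<in> topspace (hull_top J)" using U MT MH by auto
    \<comment> \<open>\<open>W\<close> brings \<open>U\<close> back to \<open>P\<close>, and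
      \<open>V0\<close> carries \<open>P\<close> into \<open>O'\<close>.\<close>
    define W' where "W' = ?m V0 W"
    have W': "W' \<in> Tcal J" "?m W' U \<in> O'"
      using Tcal_compose[OF V0(1) W(1)] V0(2) W(2) by (simp_all add: W'_def Tcal_compose_assoc[OF UT(1)])
    \<comment> \<open>Right multiplication by \<open>U\<close> is continuous and \<open>W'\<close>
      is a limit of translations, so some translation already takes \<open>U\<close> into the open
      set \<open>O'\<close>.\<close>
    have "?m W' U \<in> hull_top J closure_of ((\<lambda>V. ?m V U) ` range ?T)"
      using continuous_map_image_closure_subset[OF continuous_compose_right[OF UT(2)], of "range ?T"] W'(1)
      unfolding Tcal_hull_closure by blast
    then obtain t where "?m (?T t) U \<in> O'"
      using O'(1) W'(2) unfolding in_closure_of by blast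
    with UT(2) show ?thesis by (auto simp: N_def)
  qed
  then have "M \<subseteq> \<Union> (range N)" by blast
  then obtain \<F> where "finite \<F>" "\<F> \<subseteq> range N" "M \<subseteq> \<Union> \<F>"
    using compactinD[OF Mcomp, of "range N"] openN by blast
  then obtain F where F: "finite F" "M \<subseteq> (\<Union>t\<in>F. N t)"
    using finite_subset_image[of \<F> N UNIV] by blast
  have PM: "?m (?T x) P \<in> M" for x using transl_op_Tcal unfolding M_def by blast
  show ?thesis
  proof (rule finitely_coloured_cover[OF F(1), of _ "\<lambda>t. {x. ?m (?T x) P \<in> N t}"])
    show "\<exists>t\<in>F. x \<in> {x. ?m (?T x) P \<in> N t}" for x using F(2) PM by blast
  next
    fix t x y assume "x \<in> {x. ?m (?T x) P \<in> N t}" "y \<in> {x. ?m (?T x) P \<in> N t}"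
    \<comment> \<open>The extra translation by \<open>t\<close> is undone by reading the centre
      \<open>d\<close> at \<open>r - t\<close>. The centre depends only on the colour
      \<open>t\<close>, so it is common to \<open>x\<close> and \<open>y\<close>.\<close>
    moreover have "cmod (f (r + z) \<phi> - d (r - t)) \<le> e/2" if z: "?m (?T z) P \<in> N t" for r z
    proof -
      have "?m (?T t) (?m (?T z) P) f = transl t (transl z f)"
        using f hull_top_map_WW[OF transl_op_hull f(1), of z] by (simp add: compose_def f(1))
      then have "?m (?T t) (?m (?T z) P) f (r - t) = f (r + z)"
        by (simp add: transl_def)
      moreover have "?m (?T t) (?m (?T z) P) \<in> O'" using z by (simp add: N_def)
      ultimately show ?thesis
        using small[OF _ Mleft[OF transl_op_Tcal PM], of t z "r - t"] by simp
    qed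
    ultimately have *: "cmod (f (r + x) \<phi> - d (r - t)) \<le> e/2" "cmod (f (r + y) \<phi> - d (r - t)) \<le> e/2" for r
      by auto
    show "\<forall>r. cmod (f (r + x) \<phi> - f (r + y) \<phi>) \<le> e"
    proof
      fix r
      show "cmod (f (r + x) \<phi> - f (r + y) \<phi>) \<le> e"
        using norm_triangle_ineq4[of "f (r + x) \<phi> - d (r - t)" "f (r + y) \<phi> - d (r - t)"] *[of r] by simp
    qed
  qed
qed

section \<open>Almost periodicity of vector-valued functions\<close>

text \<open>Conditions on single values only, which exhibit the ball as a closed subset of a product
  of discs, as in the Banach-Alaoglu theorem. Real homogeneity is the case of a real scalar in
  \<open>cscale\<close>.\<close>

lemma mem_dual_ball_iff:
  "\<phi> \<in> dual_ball J \<longleftrightarrow> (\<forall>x y. \<phi> (x + y) = \<phi> x + \<phi> y) \<and> (\<forall>c x. \<phi> (cscale J c x) = c * \<phi> x) \<and>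
     (\<forall>x. cmod (\<phi> x) \<le> norm x)"
proof safe
  assume "\<phi> \<in> dual_ball J"
  then have bl: "bounded_linear \<phi>" and c: "\<And>c x. \<phi> (cscale J c x) = c * \<phi> x" and n: "onorm \<phi> \<le> 1"
    by (auto simp: dual_ball_def cdual_def dnorm_def)
  show "\<phi> (x + y) = \<phi> x + \<phi> y" for x y using bl by (simp add: linear_simps)
  show "\<phi> (cscale J c x) = c * \<phi> x" for c x by (rule c)
  show "cmod (\<phi> x) \<le> norm x" for x
    using onorm[OF bl, of x] mult_right_mono[OF n norm_ge_zero[of x]] by simp
next
  assume add: "\<forall>x y. \<phi> (x + y) = \<phi> x + \<phi> y" and c: "\<forall>c x. \<phi> (cscale J c x) = c * \<phi> x"
    and n: "\<forall>x. cmod (\<phi> x) \<le> norm x"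
  have "bounded_linear \<phi>"
  proof (rule bounded_linear_intro[where K = 1])
    show "\<phi> (r *\<^sub>R x) = r *\<^sub>R \<phi> x" for r x
      using c[rule_format, of "complex_of_real r" x] by (simp add: cscale_def scaleR_conv_of_real)
  qed (use add n in auto)
  moreover have "onorm \<phi> \<le> 1" using n by (intro onorm_bound) auto
  ultimately show "\<phi> \<in> dual_ball J" using c by (simp add: dual_ball_def cdual_def dnorm_def)
qed

lemma compact_dual_ball: "compact (dual_ball J)"
proof -
  have eval: "continuous_on UNIV (\<lambda>\<phi> :: 'a dualv. \<phi> x)" for x by simp
  have "closed {\<phi> :: 'a dualv. (\<forall>x y. \<phi> (x + y) = \<phi> x + \<phi> y) \<and> (\<forall>c x. \<phi> (cscale J c x) = c * \<phi> x)}"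
    by (intro closed_Collect_conj closed_Collect_all closed_Collect_eq continuous_on_add
        continuous_on_mult continuous_on_const eval)
  moreover have "compact {\<phi> :: 'a dualv. \<forall>x. \<phi> x \<in> cball 0 (norm x)}"
    by (intro compact_Pi_UNIV compact_cball)
  ultimately have "compact ({\<phi> :: 'a dualv. \<forall>x. \<phi> x \<in> cball 0 (norm x)} \<inter>
      {\<phi>. (\<forall>x y. \<phi> (x + y) = \<phi> x + \<phi> y) \<and> (\<forall>c x. \<phi> (cscale J c x) = c * \<phi> x)})"
    by (intro compact_Int_closed)
  also have "\<dots> = dual_ball J"
    by (auto simp: mem_dual_ball_iff)
  finally show ?thesis .
qed

lemma topspace_weakstar_dual: "topspace (weakstar_dual J) = cdual J"
proof -
  have "{\<phi> \<in> cdual J. \<phi> 0 \<in> UNIV} \<in> {{\<phi> \<in> cdual J. \<phi> x \<in> U} |x U. open U}"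
    using open_UNIV by blast
  then show ?thesis unfolding weakstar_dual_def topology_generated_by_topspace by auto
qed

lemma compactin_weakstar_dual_ball: "compactin (weakstar_dual J) (dual_ball J)"
proof -
  have "continuous_map (top_of_set (dual_ball J)) (weakstar_dual J) id"
    unfolding weakstar_dual_def
  proof (rule continuous_on_generated_topo)
    fix A assume "A \<in> {{\<phi> \<in> cdual J. \<phi> x \<in> U} |x U. open U}"
    then obtain x U where A: "A = {\<phi> \<in> cdual J. \<phi> x \<in> U}" "open U" by blast
    have "openin (top_of_set (dual_ball J)) (dual_ball J \<inter> (\<lambda>\<phi>. \<phi> x) -` U)"
      by (intro continuous_openin_preimage_gen A(2) continuous_on_subset[OF continuous_on_product_coordinates]) simp
    moreover have "id -` A \<inter> topspace (top_of_set (dual_ball J)) = dual_ball J \<inter> (\<lambda>\<phi>. \<phi> x) -` U"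
      using dual_ball_cdual by (auto simp: A(1))
    ultimately show "openin (top_of_set (dual_ball J)) (id -` A \<inter> topspace (top_of_set (dual_ball J)))"
      by simp
  next
    show "id ` topspace (top_of_set (dual_ball J)) \<subseteq> \<Union> {{\<phi> \<in> cdual J. \<phi> x \<in> U} |x U. open U}"
      using topspace_weakstar_dual[of J] dual_ball_cdual
      unfolding weakstar_dual_def topology_generated_by_topspace by auto
  qed
  moreover have "compactin (top_of_set (dual_ball J)) (dual_ball J)"
    by (simp add: compactin_subtopology compact_dual_ball)
  ultimately show ?thesis using image_compactin by fastforce
qed

text \<open>Compactness of the dual ball turns joint continuity into norm continuity of
  \<open>U \<mapsto> U f s\<close> on the compact \<open>Tcal\<close>. The image is totally bounded
  and contains every \<open>f t\<close>.\<close>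

lemma jointly_continuous_range_coloured:
  assumes f: "f \<in> WW J" and e: "e > 0"
    and F: "continuous_map (prod_topology (subtopology (weakstar_dual J) (dual_ball J)) (Tcal_top J))
           euclidean (\<lambda>(\<phi>, U). U f s \<phi>)"
  shows "finitely_coloured UNIV (\<lambda>t t'. \<forall>\<phi>\<in>dual_ball J. cmod (f t \<phi> - f t' \<phi>) \<le> e)"
proof -
  let ?B = "subtopology (weakstar_dual J) (dual_ball J)"
  have topB: "topspace ?B = dual_ball J"
    using dual_ball_cdual by (auto simp: topspace_weakstar_dual)
  have compB: "compactin ?B (dual_ball J)"
    by (simp add: compactin_subtopology compactin_weakstar_dual_ball)
  have topT: "topspace (Tcal_top J) = Tcal J"
    using Tcal_subset_hull[of J] by (auto simp: Tcal_top_hull)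
  have "\<exists>V. openin (Tcal_top J) V \<and> U0 \<in> V \<and> (\<forall>U\<in>V. \<forall>\<phi>\<in>dual_ball J. cmod (U f s \<phi> - U0 f s \<phi>) < e/2)"
    if U0: "U0 \<in> Tcal J" for U0
  proof -
    \<comment> \<open>\<open>?G\<close> vanishes on the slice over \<open>U0\<close>, so the tube
      lemma gives one neighbourhood of \<open>U0\<close> valid for all functionals of the
      ball.\<close>
    let ?G = "\<lambda>z. (\<lambda>(\<phi>, U). U f s \<phi>) z - (\<lambda>(\<phi>, U). U f s \<phi>) (fst z, U0)"
    have "continuous_map (prod_topology ?B (Tcal_top J)) (prod_topology ?B (Tcal_top J)) (\<lambda>z. (fst z, U0))"
      using U0 by (intro continuous_map_pairedI continuous_map_fst) (simp add: topT)
    from continuous_map_compose[OF this F]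
    have "continuous_map (prod_topology ?B (Tcal_top J)) euclidean ?G"
      by (intro continuous_map_diff F) (simp add: o_def)
    then have W: "openin (prod_topology ?B (Tcal_top J))
        {z \<in> topspace (prod_topology ?B (Tcal_top J)). ?G z \<in> ball 0 (e/2)}" (is "openin _ ?W")
      by (rule openin_continuous_map_preimage) simp
    have "dual_ball J \<times> {U0} \<subseteq> ?W" using U0 e topB by (auto simp: topT)
    then obtain V1 V where V: "openin (Tcal_top J) V" "dual_ball J \<subseteq> V1" "U0 \<in> V" "V1 \<times> V \<subseteq> ?W"
      using tube_lemma_left[OF W compB, of U0] U0 by (auto simp: topT)
    have "cmod (U f s \<phi> - U0 f s \<phi>) < e/2" if "U \<in> V" "\<phi> \<in> dual_ball J" for U \<phi>
    proof -
      have "(\<phi>, U) \<in> ?W" using V(2,4) that by blast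
      then show ?thesis by simp
    qed
    with V show ?thesis by blast
  qed
  then obtain V where V: "\<And>U. U \<in> Tcal J \<Longrightarrow> openin (Tcal_top J) (V U)" "\<And>U. U \<in> Tcal J \<Longrightarrow> U \<in> V U"
    "\<And>U U' \<phi>. U \<in> Tcal J \<Longrightarrow> U' \<in> V U \<Longrightarrow> \<phi> \<in> dual_ball J \<Longrightarrow> cmod (U' f s \<phi> - U f s \<phi>) < e/2"
    by metis
  have "compactin (Tcal_top J) (Tcal J)"
    by (simp add: Tcal_top_hull compactin_subtopology compactin_Tcal)
  moreover have "Tcal J \<subseteq> \<Union> (V ` Tcal J)" using V(2) by blast
  ultimately obtain \<F> where "finite \<F>" "\<F> \<subseteq> V ` Tcal J" "Tcal J \<subseteq> \<Union> \<F>"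
    using compactinD[of "Tcal_top J" "Tcal J" "V ` Tcal J"] V(1) by blast
  then obtain K where K: "finite K" "K \<subseteq> Tcal J" "Tcal J \<subseteq> \<Union> (V ` K)"
    using finite_subset_image[of \<F> V "Tcal J"] by blast
  show ?thesis
  \<comment> \<open>Translating by \<open>t - s\<close> and evaluating at \<open>s\<close> gives
    \<open>f t\<close>.\<close>
  proof (rule finitely_coloured_cover[OF K(1), of _ "\<lambda>U. {t. transl_op J (t - s) \<in> V U}"])
    show "\<exists>U\<in>K. t \<in> {t. transl_op J (t - s) \<in> V U}" for t
      using K(3) transl_op_Tcal[of "t - s" J] by blast
  next
    fix U t t' assume U: "U \<in> K" and t: "t \<in> {t. transl_op J (t - s) \<in> V U}" "t' \<in> {t. transl_op J (t - s) \<in> V U}"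
    have *: "cmod (f u \<phi> - U f s \<phi>) < e/2" if "transl_op J (u - s) \<in> V U" "\<phi> \<in> dual_ball J" for u \<phi>
      using V(3)[OF _ that] U K(2) f by (auto simp: transl_def)
    show "\<forall>\<phi>\<in>dual_ball J. cmod (f t \<phi> - f t' \<phi>) \<le> e"
    proof
      fix \<phi> assume \<phi>: "\<phi> \<in> dual_ball J"
      have "cmod (f t \<phi> - U f s \<phi>) < e/2" "cmod (f t' \<phi> - U f s \<phi>) < e/2" using * t \<phi> by auto
      then show "cmod (f t \<phi> - f t' \<phi>) \<le> e"
        using norm_triangle_ineq4[of "f t \<phi> - U f s \<phi>" "f t' \<phi> - U f s \<phi>"] by simp
    qed
  qed
qed

text \<open>The times in \<open>T0\<close> give a finite net for the range of \<open>f\<close>, and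
  \<open>\<Phi>\<close> is a finite net of the ball as seen through these times. Two functionals
  that nearly agree on \<open>T0\<close> nearly agree along all of \<open>f\<close>, so merging the
  scalar colourings for \<open>\<Phi>\<close> handles the whole ball.\<close>

lemma weakly_almost_periodic_coloured:
  assumes f: "f \<in> BUC J" and e: "e > 0"
    and range: "\<And>e. e > 0 \<Longrightarrow> finitely_coloured UNIV (\<lambda>t t'. \<forall>\<phi>\<in>dual_ball J. cmod (f t \<phi> - f t' \<phi>) \<le> e)"
    and scalar: "\<And>\<phi> e. \<phi> \<in> dual_ball J \<Longrightarrow> e > 0 \<Longrightarrow>
      finitely_coloured UNIV (\<lambda>t t'. \<forall>r. cmod (f (r + t) \<phi> - f (r + t') \<phi>) \<le> e)"
  shows "finitely_coloured UNIV (\<lambda>t t'. \<forall>r. \<forall>\<phi>\<in>dual_ball J. cmod (f (r + t) \<phi> - f (r + t') \<phi>) \<le> e)"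
proof -
  \<comment> \<open>Replacing \<open>\<phi>\<close> by a member of \<open>\<Phi>\<close> costs
    \<open>3 * \<delta>\<close> at each of the two times, and the scalar colouring costs one more
    \<open>\<delta>\<close>.\<close>
  define \<delta> where "\<delta> = e / 7"
  have \<delta>: "\<delta> > 0" using e by (simp add: \<delta>_def)
  obtain T0 where T0: "finite T0" "\<And>t. \<exists>b\<in>T0. \<forall>\<phi>\<in>dual_ball J. cmod (f t \<phi> - f b \<phi>) \<le> \<delta>"
    using finitely_coloured_representatives[OF range[OF \<delta>]] by (metis UNIV_I)
  have fb: "\<And>r. f r \<in> bidual J" using f by (simp add: BUC_def)
  have "bounded (f b ` dual_ball J)" for b
    using bnorm_upper[OF fb] by (intro boundedI[of _ "bnorm J (f b)"]) auto
  then have "finitely_coloured (dual_ball J) (\<lambda>\<phi> \<psi>. \<forall>b\<in>T0. cmod (f b \<phi> - f b \<psi>) \<le> \<delta>)"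
    by (intro finitely_coloured_ball[OF T0(1)] finitely_coloured_bounded \<delta>)
  then obtain \<Phi> where \<Phi>: "finite \<Phi>" "\<Phi> \<subseteq> dual_ball J"
    "\<And>\<phi>. \<phi> \<in> dual_ball J \<Longrightarrow> \<exists>\<psi>\<in>\<Phi>. \<forall>b\<in>T0. cmod (f b \<phi> - f b \<psi>) \<le> \<delta>"
    by (rule finitely_coloured_representatives) (rule that)
  have net: "\<exists>\<psi>\<in>\<Phi>. \<forall>t. cmod (f t \<phi> - f t \<psi>) \<le> 3 * \<delta>" if \<phi>: "\<phi> \<in> dual_ball J" for \<phi>
  proof -
    obtain \<psi> where \<psi>: "\<psi> \<in> \<Phi>" "\<And>b. b \<in> T0 \<Longrightarrow> cmod (f b \<phi> - f b \<psi>) \<le> \<delta>" using \<Phi>(3)[OF \<phi>] by blast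
    have "cmod (f t \<phi> - f t \<psi>) \<le> 3 * \<delta>" for t
    proof -
      obtain b where b: "b \<in> T0" "\<And>\<phi>. \<phi> \<in> dual_ball J \<Longrightarrow> cmod (f t \<phi> - f b \<phi>) \<le> \<delta>" using T0(2)[of t] by blast
      have "dist (f t \<phi>) (f b \<phi>) \<le> \<delta>" "dist (f b \<phi>) (f b \<psi>) \<le> \<delta>" "dist (f t \<psi>) (f b \<psi>) \<le> \<delta>"
        using b(2)[OF \<phi>] \<psi>(2)[OF b(1)] b(2)[of \<psi>] \<psi>(1) \<Phi>(2) by (auto simp: dist_norm)
      moreover have "dist (f t \<phi>) (f t \<psi>) \<le> dist (f t \<phi>) (f b \<phi>) + dist (f b \<phi>) (f b \<psi>) + dist (f t \<psi>) (f b \<psi>)"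
        by metric
      ultimately show ?thesis by (simp add: dist_norm)
    qed
    with \<psi>(1) show ?thesis by blast
  qed
  have "finitely_coloured UNIV (\<lambda>t t'. \<forall>\<psi>\<in>\<Phi>. \<forall>r. cmod (f (r + t) \<psi> - f (r + t') \<psi>) \<le> \<delta>)"
    using \<Phi>(2) by (intro finitely_coloured_ball[OF \<Phi>(1)] scalar \<delta>) blast
  then show ?thesis
  proof (rule finitely_coloured_mono)
    fix t t' assume tt: "\<forall>\<psi>\<in>\<Phi>. \<forall>r. cmod (f (r + t) \<psi> - f (r + t') \<psi>) \<le> \<delta>"
    show "\<forall>r. \<forall>\<phi>\<in>dual_ball J. cmod (f (r + t) \<phi> - f (r + t') \<phi>) \<le> e"
    proof (intro allI ballI)
      fix r \<phi> assume "\<phi> \<in> dual_ball J"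
      then obtain \<psi> where \<psi>: "\<psi> \<in> \<Phi>" "\<And>t. cmod (f t \<phi> - f t \<psi>) \<le> 3 * \<delta>" using net by blast
      have "dist (f (r + t) \<phi>) (f (r + t) \<psi>) \<le> 3 * \<delta>" "dist (f (r + t) \<psi>) (f (r + t') \<psi>) \<le> \<delta>"
        "dist (f (r + t') \<phi>) (f (r + t') \<psi>) \<le> 3 * \<delta>"
        using \<psi> tt by (auto simp: dist_norm)
      moreover have "dist (f (r + t) \<phi>) (f (r + t') \<phi>) \<le> dist (f (r + t) \<phi>) (f (r + t) \<psi>)
          + dist (f (r + t) \<psi>) (f (r + t') \<psi>) + dist (f (r + t') \<phi>) (f (r + t') \<psi>)"
        by metric
      ultimately have "dist (f (r + t) \<phi>) (f (r + t') \<phi>) \<le> 7 * \<delta>" by simp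
      then show "cmod (f (r + t) \<phi> - f (r + t') \<phi>) \<le> e" by (simp add: \<delta>_def dist_norm)
    qed
  qed
qed

lemma pointwise_limit_of_translates:
  fixes f :: "real \<Rightarrow> 'b \<Rightarrow> 'c::topological_space"
  assumes "\<And>r \<phi>. (\<lambda>n. f (r + u n) \<phi>) \<longlonglongrightarrow> h r \<phi>"
  shows "h \<in> closure (translates f)"
proof -
  have "limitin (product_topology (\<lambda>_. euclidean) UNIV) (\<lambda>n. f (r + u n)) (h r) sequentially" for r
    unfolding limitin_componentwise using assms by simp
  then have "(\<lambda>n. f (r + u n)) \<longlonglongrightarrow> h r" for r
    by (simp only: euclidean_product_topology limitin_canonical_iff)
  then have "limitin (product_topology (\<lambda>_. euclidean) UNIV) (\<lambda>n r. f (r + u n)) h sequentially"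
    unfolding limitin_componentwise by simp
  then have "(\<lambda>n r. f (r + u n)) \<longlonglongrightarrow> h"
    by (simp only: euclidean_product_topology limitin_canonical_iff)
  moreover have "(\<lambda>r. f (r + u n)) \<in> closure (translates f)" for n
    by (rule subsetD[OF closure_subset]) (rule rangeI)
  then have "\<forall>\<^sub>F n in sequentially. (\<lambda>r. f (r + u n)) \<in> closure (translates f)" by simp
  ultimately show ?thesis
    by (intro Lim_in_closed_set[OF closed_closure _ sequentially_bot])
qed

text \<open>Colourings with tolerances \<open>1/(k+1)\<close> give a uniformly Cauchy subsequence of
  translates. Its limit is formed separately for each time and functional; lying in the orbit
  closure, it takes values in the bidual, and the Cauchy bounds pass to the limit uniformly.\<close>

lemma coloured_imp_AP_bidual:
  assumes f: "f \<in> BUC J"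
    and col: "\<And>e. e > 0 \<Longrightarrow> finitely_coloured UNIV (\<lambda>t t'. \<forall>r. \<forall>\<phi>\<in>dual_ball J. cmod (f (r + t) \<phi> - f (r + t') \<phi>) \<le> e)"
  shows "f \<in> AP_bidual J"
proof -
  have fb: "\<And>r. f r \<in> bidual J" using f by (simp add: BUC_def)
  have "\<exists>(\<sigma> :: nat \<Rightarrow> nat) h. strict_mono \<sigma> \<and> (\<forall>r. h r \<in> bidual J) \<and>
        (\<forall>e>0. \<exists>N. \<forall>n\<ge>N. \<forall>r. bdist J (f (r + t (\<sigma> n))) (h r) < e)" for t :: "nat \<Rightarrow> real"
  proof -
    have "finitely_coloured UNIV
        (\<lambda>t t'. \<forall>r. \<forall>\<phi>\<in>dual_ball J. cmod (f (r + t) \<phi> - f (r + t') \<phi>) \<le> inverse (Suc k))" for k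
      by (rule col) simp
    then obtain \<sigma> where \<sigma>: "strict_mono \<sigma>"
      and close: "\<And>k i j. k < i \<Longrightarrow> k < j \<Longrightarrow>
        \<forall>r. \<forall>\<phi>\<in>dual_ball J. cmod (f (r + t (\<sigma> i)) \<phi> - f (r + t (\<sigma> j)) \<phi>) \<le> inverse (Suc k)"
      by (rule finitely_coloured_subsequence[where t = t]) (rule that)
    define x where "x r \<phi> n = f (r + t (\<sigma> n)) \<phi>" for r \<phi> n
    \<comment> \<open>Arguments outside \<open>cdual J\<close> are included, with constant value 0,
      so that \<open>h\<close> is a pointwise limit on the whole function type.\<close>
    have "convergent (x r \<phi>)" for r \<phi>
    proof (cases "\<phi> \<in> cdual J")
      case True
      have "Cauchy (x r \<phi>)"
      proof (rule metric_CauchyI)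
        fix e :: real assume "e > 0"
        then have "0 < e / (dnorm \<phi> + 1)" using dnorm_nonneg[OF True] by simp
        then obtain k where k: "inverse (real (Suc k)) < e / (dnorm \<phi> + 1)"
          using reals_Archimedean by blast
        have "dist (x r \<phi> i) (x r \<phi> j) < e" if "i \<ge> Suc k" "j \<ge> Suc k" for i j
        proof -
          have "bdist J (f (r + t (\<sigma> i))) (f (r + t (\<sigma> j))) \<le> inverse (Suc k)"
            using close[of k i j] that by (intro bdist_le) simp
          then have "cmod (x r \<phi> i - x r \<phi> j) \<le> inverse (Suc k) * dnorm \<phi>"
            unfolding x_def
            using bdist_bound[OF fb fb True, of "r + t (\<sigma> i)" "r + t (\<sigma> j)"] dnorm_nonneg[OF True]
            by (meson mult_right_mono order_trans)
          also have "\<dots> \<le> inverse (Suc k) * (dnorm \<phi> + 1)" by (intro mult_left_mono) auto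
          also have "\<dots> < e" using k dnorm_nonneg[OF True] by (simp add: field_simps)
          finally show ?thesis by (simp add: dist_norm)
        qed
        then show "\<exists>M. \<forall>m\<ge>M. \<forall>n\<ge>M. dist (x r \<phi> m) (x r \<phi> n) < e" by blast
      qed
      then show ?thesis by (simp add: Cauchy_convergent_iff)
    next
      case False
      then have "x r \<phi> = (\<lambda>n. 0)" using bidual_outside[OF fb] by (auto simp: x_def)
      then show ?thesis by (simp add: convergent_const)
    qed
    then obtain h where h: "\<And>r \<phi>. x r \<phi> \<longlonglongrightarrow> h r \<phi>" unfolding convergent_def by metis
    have "h \<in> closure (translates f)"
      using h by (intro pointwise_limit_of_translates[where u = "\<lambda>n. t (\<sigma> n)"]) (simp add: x_def[abs_def])
    then have hb: "h r \<in> bidual J" for r by (rule closure_translates_bidual[OF f])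
    have "\<exists>N. \<forall>n\<ge>N. \<forall>r. bdist J (f (r + t (\<sigma> n))) (h r) < e" if "e > 0" for e
    proof -
      obtain k where k: "inverse (real (Suc k)) < e" using reals_Archimedean[OF \<open>e > 0\<close>] by blast
      have "bdist J (f (r + t (\<sigma> n))) (h r) \<le> inverse (Suc k)" if "n \<ge> Suc k" for n r
      proof (rule bdist_le)
        fix \<phi> assume \<phi>: "\<phi> \<in> dual_ball J"
        have "(\<lambda>m. cmod (f (r + t (\<sigma> n)) \<phi> - x r \<phi> m)) \<longlonglongrightarrow> cmod (f (r + t (\<sigma> n)) \<phi> - h r \<phi>)"
          by (intro tendsto_norm tendsto_diff tendsto_const h)
        then show "cmod (f (r + t (\<sigma> n)) \<phi> - h r \<phi>) \<le> inverse (Suc k)"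
        proof (rule LIMSEQ_le_const2)
          show "\<exists>N. \<forall>m\<ge>N. cmod (f (r + t (\<sigma> n)) \<phi> - x r \<phi> m) \<le> inverse (Suc k)"
            using close[of k n] that \<phi> by (intro exI[of _ "Suc k"]) (auto simp: x_def)
        qed
      qed
      then show ?thesis using k by (meson le_less_trans)
    qed
    with \<sigma> hb show ?thesis by blast
  qed
  moreover have "\<exists>d>0. \<forall>s. \<bar>s - r\<bar> < d \<longrightarrow> bdist J (f s) (f r) < e" if "e > 0" for r e
    using f that unfolding BUC_def by blast
  ultimately show ?thesis using fb unfolding AP_bidual_def by blast
qed

theorem theorem8p4:
  fixes J :: "'a::banach \<Rightarrow> 'a"
    and P :: "(real \<Rightarrow> 'a bidualv) \<Rightarrow> (real \<Rightarrow> 'a bidualv)"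
    and f :: "real \<Rightarrow> 'a bidualv"
    and s :: real
  assumes "complex_structure J"
    and "minimal_idempotent J P"
    and "f \<in> P ` WW J"
    and "norm_separable J (weakstar_bidual J closure_of (range f))"
    and "continuous_map (prod_topology (subtopology (weakstar_dual J) (dual_ball J)) (Tcal_top J))
           euclidean (\<lambda>(\<phi>, U). U f s \<phi>)"
  shows "f \<in> AP_bidual J"
proof -
  have P: "P \<in> topspace (hull_top J)" "compose (WW J) P P = P"
    using assms(2) Tcal_subset_hull unfolding minimal_idempotent_def by blast+
  obtain f0 where f0: "f0 \<in> WW J" "f = P f0" using assms(3) by blast
  have f: "f \<in> WW J" unfolding f0(2) by (rule hull_top_map_WW[OF P(1) f0(1)])
  have "compose (WW J) P P f0 = P f0" by (simp only: P(2))
  then have Pf: "P f = f" using f0 by (simp add: compose_def)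
  have fB: "f \<in> BUC J" using f by (simp add: WW_def)
  show ?thesis
  proof (rule coloured_imp_AP_bidual[OF fB], rule weakly_almost_periodic_coloured[OF fB])
    show "finitely_coloured UNIV (\<lambda>t t'. \<forall>\<phi>\<in>dual_ball J. cmod (f t \<phi> - f t' \<phi>) \<le> e)" if "e > 0" for e
      by (rule jointly_continuous_range_coloured[OF f that assms(5)])
    show "finitely_coloured UNIV (\<lambda>t t'. \<forall>r. cmod (f (r + t) \<phi> - f (r + t') \<phi>) \<le> e)"
      if "\<phi> \<in> dual_ball J" "e > 0" for \<phi> e
      by (rule reversible_scalar_almost_periodic[OF assms(2) f Pf dual_ball_cdual[OF that(1)] that(2)])
  qed
qed

end
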